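(* Let $\sigma>0$, $\gamma>0$, $K\ge 1$ an integer, $\Delta=2\gamma/K$, $P_0>0$, $\varepsilon\in(0,1)$, and let $\bar W=W+W_q$ with $W\sim\mathcal N(0,\sigma^2)$ and $W_q\sim\mathcal U(-\Delta/2,\Delta/2)$ independent. Let $F_{\bar W}$ be the cumulative distribution function of $\bar W$, and let $A>0$ satisfy $1-[F_{\bar W}(\gamma-A)-F_{\bar W}(-\gamma-A)]=\varepsilon$. Let $\mathcal F$ be the set of probability distributions $P_X$ on $\mathbb R$ with $|X|\le A$ almost surely and $\mathbb E[X^2]\le P_0$, and let $C(A,P_0)$ be the capacity of the additive-noise channel $Y=X+\bar W$ over inputs in $\mathcal F$ (as defined in the context). Then $$C(A,P_0)\ge \frac12\log\!\left(e^{2h_{\max}(A,P_0)}+e^{2h(\bar W)}\right)-h(\bar W),$$ where $h_{\max}(A,P_0):=\sup_{P_X\in\mathcal F}h(X)$. Moreover, $$h_{\max}(A,P_0)=\begin{cases}\log(2A), & P_0\ge \dfrac{A^2}{3},\\[1ex] -\log c+\mu^\star P_0, & P_0<\dfrac{A^2}{3},\end{cases}$$ with $$c=\frac{\sqrt{\mu^\star}}{\sqrt{\pi}\,\bigl(1-2Q(\sqrt{2\mu^\star}\,A)\bigr)},$$ where $\mu^\star>0$ solves $$\frac{1}{2\mu^\star}-\frac{A e^{-\mu^\star A^2}}{\sqrt{\pi\mu^\star}\,\bigl(1-2Q(\sqrt{2\mu^\star}\,A)\bigr)}=P_0.$$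
   Context: Channel model: the real-valued input $X$ is independent of the noise $\bar W$, and the output is $Y=X+\bar W$, where $\bar W=W+W_q$ is the sum of independent Gaussian noise $W\sim\mathcal N(0,\sigma^2)$ and uniform noise $W_q\sim\mathcal U(-\Delta/2,\Delta/2)$. (This represents an additive Gaussian channel followed by a $K$-level subtractive dithered uniform quantizer with range $[-\gamma,\gamma]$ and step size $\Delta=2\gamma/K$; the peak amplitude $A$ is the one for which the overload probability $\Pr(|x+W+D|>\gamma)$ at $x=A$, with dither $D\sim\mathcal U(-\Delta/2,\Delta/2)$ independent of $W$, equals the tolerance $\varepsilon$.) Capacity: $C(A,P_0)=\sup_{P_X\in\mathcal F} I(X;Y)$, where $\mathcal F=\{P_X:\ \mathbb E[X^2]\le P_0,\ |X|\le A \text{ almost surely}\}$ and $I(X;Y)$ is the mutual information. For this channel $I(X;Y)=h(Y)-h(\bar W)$. $h(\cdot)$ denotes differential entropy: $h(V)=-\int f_V\log f_V$ for a random variable $V$ with density $f_V$, and $h(V)=-\infty$ if $V$ has no density. Logarithms are natural, and mutual information and entropy are measured in nats. $Q(x)=\frac{1}{\sqrt{2\pi}}\int_x^\infty e^{-t^2/2}\,dt$ is the Gaussian $Q$-function. *)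

theory Defs
  imports "HOL-Probability.Probability"
begin

(* Differential entropy in nats of a law P on the reals, with value -\<infinity> if P has no density.
   When a density exists, RN_deriv lborel P is one.  The integral of -f ln f is the difference of
   the integrals of its positive and negative parts (ennreal truncates negative numbers to 0);
   ln 0 = 0 gives the convention 0 ln 0 = 0.  If both parts are infinite the integral is undefined
   and the expression evaluates to \<infinity>; for a law concentrated on a bounded interval, or with a
   bounded density, at most one part is infinite. *)
definition differential_entropy :: "real measure \<Rightarrow> ereal" where
  "differential_entropy P =
     (if \<exists>f \<in> borel_measurable lborel. density lborel f = P
      then (let f = (\<lambda>x. enn2real (RN_deriv lborel P x))
            in enn2ereal (\<integral>\<^sup>+ x. ennreal (- (f x * ln (f x))) \<partial>lborel)
             - enn2ereal (\<integral>\<^sup>+ x. ennreal (f x * ln (f x)) \<partial>lborel))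
      else - \<infinity>)"

lemma differential_entropy_density:
  fixes f :: "real \<Rightarrow> real"
  assumes [measurable]: "f \<in> borel_measurable borel" and nonneg: "\<And>x. 0 \<le> f x"
    and int: "integrable lborel (\<lambda>x. f x * ln (f x))"
  shows "differential_entropy (density lborel (\<lambda>x. ennreal (f x)))
       = ereal (- (\<integral>x. f x * ln (f x) \<partial>lborel))"
proof -
  let ?P = "density lborel (\<lambda>x. ennreal (f x))"
  let ?g = "\<lambda>x. enn2real (RN_deriv lborel ?P x)"
  have "AE x in lborel. ennreal (f x) = RN_deriv lborel ?P x"
    by (intro sigma_finite_measure.RN_deriv_unique[OF sigma_finite_lborel]) auto
  then have ae: "AE x in lborel. ?g x = f x"
    by (eventually_elim) (drule sym, simp add: nonneg)
  have pos: "(\<integral>\<^sup>+ x. ennreal (- (?g x * ln (?g x))) \<partial>lborel)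
           = (\<integral>\<^sup>+ x. ennreal (- (f x * ln (f x))) \<partial>lborel)"
    by (intro nn_integral_cong_AE, use ae in eventually_elim) simp
  have neg: "(\<integral>\<^sup>+ x. ennreal (?g x * ln (?g x)) \<partial>lborel)
           = (\<integral>\<^sup>+ x. ennreal (f x * ln (f x)) \<partial>lborel)"
    by (intro nn_integral_cong_AE, use ae in eventually_elim) simp
  obtain p q where pq: "0 \<le> p" "0 \<le> q"
    "(\<integral>\<^sup>+ x. ennreal (f x * ln (f x)) \<partial>lborel) = ennreal p"
    "(\<integral>\<^sup>+ x. ennreal (- (f x * ln (f x))) \<partial>lborel) = ennreal q"
    "(\<integral>x. f x * ln (f x) \<partial>lborel) = p - q"
    by (rule integrableE[OF int]) (rule that)
  have ex: "\<exists>h \<in> borel_measurable lborel. density lborel h = ?P"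
    by (rule bexI[of _ "\<lambda>x. ennreal (f x)"]) auto
  show ?thesis
    unfolding differential_entropy_def Let_def if_P[OF ex] pos neg
    using pq by (simp add: enn2ereal_ennreal)
qed

definition admissible_inputs :: "real \<Rightarrow> real \<Rightarrow> real measure set" where
  "admissible_inputs A P0 =
     {P. prob_space P \<and> sets P = sets borel \<and> (AE x in P. \<bar>x\<bar> \<le> A) \<and> (\<integral>x. x\<^sup>2 \<partial>P) \<le> P0}"

(* I(X; X + Z) in nats for independent X with law P and Z with law N, realised as the
   coordinates of the product space.  mutual_information is real-valued, so it agrees with the
   textbook value only when that value is finite, as it is for P of bounded support and N with a
   Gaussian component. *)
definition channel_mutual_information :: "real measure \<Rightarrow> real measure \<Rightarrow> real" where
  "channel_mutual_information P N =
     prob_space.mutual_information (P \<Otimes>\<^sub>M N) (exp 1) borel borel fst (\<lambda>(x, z). x + z)"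

definition capacity :: "real measure \<Rightarrow> real \<Rightarrow> real \<Rightarrow> ereal" where
  "capacity N A P0 = (SUP P \<in> admissible_inputs A P0. ereal (channel_mutual_information P N))"

definition max_entropy :: "real \<Rightarrow> real \<Rightarrow> ereal" where
  "max_entropy A P0 = (SUP P \<in> admissible_inputs A P0. differential_entropy P)"

definition gauss_Q :: "real \<Rightarrow> real" where
  "gauss_Q x = 1 / sqrt (2 * pi) * (LBINT t:{x..}. exp (- t\<^sup>2 / 2))"

end

theory Submission
  imports Defs
begin

text \<open>The bound is the entropy power inequality for the sum of the entropy maximizing input and the
  noise. Following Rioul's transport argument, write the two variables as \<open>T(X)\<close> and \<open>U(Y)\<close> with
  \<open>X\<close>, \<open>Y\<close> independent standard Gaussians and \<open>T\<close>, \<open>U\<close> increasing. For \<open>a\<^sup>2 + b\<^sup>2 = 1\<close> the rotated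
  pair \<open>a X + b Y\<close>, \<open>a Y - b X\<close> is again standard Gaussian, and for a fixed second coordinate the sum
  \<open>T(X) + U(Y)\<close> is an increasing function of the first, with derivative \<open>a T'(X) + b U'(Y)\<close>. Gibbs'
  inequality for this conditional law and concavity of the logarithm yield
  \<open>h(T(X) + U(Y)) \<ge> a\<^sup>2 (h(T(X)) - ln a) + b\<^sup>2 (h(U(Y)) - ln b)\<close>; now optimize over \<open>a\<close> and \<open>b\<close>.
  The entropy maximizer is a centered Gaussian truncated to \<open>[-A, A]\<close> (uniform for \<open>\<mu> = 0\<close>), by
  Gibbs' inequality again.\<close>

section \<open>Gaussian transport of densities supported on an interval\<close>

text \<open>The obstacle is regularity: the maximizing density jumps to 0 at the ends of [-A, A],
  while the noise density is positive on the whole line. The transport argument only asks for a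
  support that is an open interval and for continuity there. Then T is C^1 and maps the line onto
  the support. The range of the conditional map in the Gibbs step need not be identified, since p
  has mass at most 1 on any set.

  The noise and output densities are never computed. They are kept between two Gaussians, which
  makes all their logarithms finite and their entropy integrals absolutely convergent. Infinite
  entropies therefore occur only among the competing inputs in the supremum.

  For the capacity a single input suffices: at the maximizer the mutual information is h(Y) - h(N),
  and the entropy power inequality bounds h(Y) from below.\<close>

lemma nn_integral_substitution_UNIV:
  fixes k g g' :: "real \<Rightarrow> real"
  assumes [measurable]: "k \<in> borel_measurable borel"
    and g: "\<And>x. (g has_real_derivative g' x) (at x)"
    and g': "continuous_on UNIV g'" "\<And>x. 0 \<le> g' x"
  shows "(\<integral>\<^sup>+x. ennreal (k (g x) * g' x) \<partial>lborel) = (\<integral>\<^sup>+x. ennreal (k x) * indicator (range g) x \<partial>lborel)"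
proof -
  have contg: "continuous_on UNIV g"
    using g by (intro continuous_at_imp_continuous_on) (auto intro: DERIV_isCont)
  have mono: "g x \<le> g y" if "x \<le> y" for x y
    by (rule DERIV_nonneg_imp_nondecreasing[OF that]) (use g g' in blast)
  have [measurable]: "g \<in> borel_measurable borel" "g' \<in> borel_measurable borel"
    using contg g'(1) by (auto intro: borel_measurable_continuous_onI)
  have img: "{g (- real n)..g (real n)} \<subseteq> range g" for n
  proof
    fix y assume "y \<in> {g (- real n)..g (real n)}"
    then have "\<exists>x\<ge>- real n. x \<le> real n \<and> g x = y"
      by (intro IVT') (auto intro: continuous_on_subset[OF contg])
    then show "y \<in> range g" by auto
  qed
  have union: "range g = (\<Union>n. {g (- real n)..g (real n)})"
  proof (intro subset_antisym subsetI)
    fix y assume "y \<in> range g"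
    then obtain x where x: "y = g x" by auto
    obtain n where "\<bar>x\<bar> \<le> real n" using real_arch_simple by blast
    then have "y \<in> {g (- real n)..g (real n)}" by (auto simp: x abs_le_iff intro!: mono)
    then show "y \<in> (\<Union>n. {g (- real n)..g (real n)})" by blast
  qed (use img in blast)
  have inc: "incseq (\<lambda>n. {g (- real n)..g (real n)})"
    by (force simp: incseq_def intro: mono order_trans)
  have [measurable]: "range g \<in> sets borel" unfolding union by measurable
  have UN: "(\<Union>n. {- real n..real n}) = UNIV"
  proof -
    have "\<exists>n. - real n \<le> x \<and> x \<le> real n" for x
      using real_arch_simple[of "\<bar>x\<bar>"] by (auto simp: abs_le_iff) (metis minus_le_iff)
    then show ?thesis by auto
  qed
  have inc2: "incseq (\<lambda>n. {- real n..real n})" by (force simp: incseq_def)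
  \<comment> \<open>Substitution is applied on [-n, n]. Both sides are read as measures of
    increasing unions, of the sets [-n, n] on the left and [g(-n), g(n)] on the right, which are
    compared term by term.\<close>
  let ?L = "\<lambda>h. density lborel (\<lambda>x. ennreal (h x))"
  have "(\<integral>\<^sup>+x. ennreal (k (g x) * g' x) \<partial>lborel) = emeasure (?L (\<lambda>x. k (g x) * g' x)) (\<Union>n. {- real n..real n})"
    by (simp add: UN emeasure_density)
  also have "\<dots> = (SUP n. emeasure (?L (\<lambda>x. k (g x) * g' x)) {- real n..real n})"
    by (intro SUP_emeasure_incseq[symmetric] inc2) auto
  also have "\<dots> = (SUP n. emeasure (?L k) {g (- real n)..g (real n)})"
  proof (rule SUP_cong[OF refl])
    fix n
    have "emeasure (?L (\<lambda>x. k (g x) * g' x)) {- real n..real n}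
      = (\<integral>\<^sup>+x. ennreal (k (g x) * g' x * indicator {- real n..real n} x) \<partial>lborel)"
      by (subst emeasure_density) (auto intro!: nn_integral_cong split: split_indicator)
    also have "\<dots> = (\<integral>\<^sup>+x. ennreal (k x * indicator {g (- real n)..g (real n)} x) \<partial>lborel)"
      using g g' by (intro nn_integral_substitution[symmetric])
        (auto simp: set_borel_measurable_def intro: continuous_on_subset[OF g'(1)])
    also have "\<dots> = emeasure (?L k) {g (- real n)..g (real n)}"
      by (subst emeasure_density) (auto intro!: nn_integral_cong split: split_indicator)
    finally show "emeasure (?L (\<lambda>x. k (g x) * g' x)) {- real n..real n}
      = emeasure (?L k) {g (- real n)..g (real n)}" .
  qed
  also have "\<dots> = emeasure (?L k) (range g)"
    unfolding union by (intro SUP_emeasure_incseq inc) auto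
  also have "\<dots> = (\<integral>\<^sup>+x. ennreal (k x) * indicator (range g) x \<partial>lborel)"
    by (simp add: emeasure_density)
  finally show ?thesis .
qed

text \<open>Continuity is required only on the support, so that the truncated Gaussian with its
  jumps at the end points is an instance. An open interval as support makes the cdf a C^1 bijection
  from the support onto (0, 1).\<close>

locale interval_density =
  fixes f :: "real \<Rightarrow> real"
  assumes measurable_f[measurable]: "f \<in> borel_measurable borel"
    and nonneg: "0 \<le> f x"
    and nn_integral_eq_1: "(\<integral>\<^sup>+x. ennreal (f x) \<partial>lborel) = 1"
    and open_support: "open {x. 0 < f x}"
    and interval_support: "is_interval {x. 0 < f x}"
    and continuous: "continuous_on {x. 0 < f x} f"
begin

abbreviation law :: "real measure" where
  "law \<equiv> density lborel (\<lambda>x. ennreal (f x))"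

sublocale real_distribution law
proof -
  have "prob_space law"
    by (intro prob_spaceI) (simp add: emeasure_density nn_integral_eq_1)
  then show "real_distribution law"
    by (simp add: real_distribution_def real_distribution_axioms_def)
qed

lemma cdf_diff_support:
  assumes "x \<le> y" "{x..y} \<subseteq> {x. 0 < f x}"
  shows "cdf law y - cdf law x = integral {x..y} f"
proof -
  have c: "continuous_on {x..y} f" using continuous_on_subset[OF continuous assms(2)] .
  have "cdf law y - cdf law x = measure law {x<..y}"
    using assms(1) by (cases "x = y") (auto simp: cdf_diff_eq)
  also have "\<dots> = enn2real (\<integral>\<^sup>+t. ennreal (f t) * indicator {x..y} t \<partial>lborel)"
    unfolding measure_def by (subst emeasure_density)
      (auto intro!: arg_cong[where f=enn2real] nn_integral_cong_AE AE_I'[of "{x}"] split: split_indicator split_indicator_asm)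
  also have "(\<integral>\<^sup>+t. ennreal (f t) * indicator {x..y} t \<partial>lborel) = (\<integral>\<^sup>+t. ennreal (indicator {x..y} t *\<^sub>R f t) \<partial>lborel)"
    by (intro nn_integral_cong) (auto split: split_indicator)
  also have "\<dots> = ennreal (set_lebesgue_integral lborel {x..y} f)"
    unfolding set_lebesgue_integral_def
    by (intro nn_integral_eq_integral borel_integrable_compact c) (auto simp: nonneg)
  also have "set_lebesgue_integral lborel {x..y} f = integral {x..y} f"
    by (intro set_borel_integral_eq_integral(2)) (use borel_integrable_compact[OF _ c] in \<open>auto simp: set_integrable_def\<close>)
  also have "enn2real (ennreal (integral {x..y} f)) = integral {x..y} f"
    by (intro enn2real_ennreal Henstock_Kurzweil_Integration.integral_nonneg integrable_continuous_real c) (auto simp: nonneg)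
  finally show ?thesis .
qed

lemma support_nbhd:
  assumes "0 < f y"
  obtains e where "e > 0" "{y - e..y + e} \<subseteq> {x. 0 < f x}"
  using open_support assms unfolding open_contains_cball
  by (metis cball_eq_atLeastAtMost mem_Collect_eq)

text \<open>Openness of the support gives a compact interval around y on which f is continuous;
  there the cdf is a constant plus an integral with variable upper limit.\<close>

lemma DERIV_cdf:
  assumes "0 < f y"
  shows "(cdf law has_real_derivative f y) (at y)"
proof -
  obtain e where e: "e > 0" "{y - e..y + e} \<subseteq> {x. 0 < f x}"
    using support_nbhd[OF assms] .
  let ?a = "y - e" and ?b = "y + e"
  have c: "continuous_on {?a..?b} f" using continuous_on_subset[OF continuous e(2)] .
  have "((\<lambda>t. integral {?a..t} f) has_real_derivative f y) (at y within {?a..?b})"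
    using e c by (intro integral_has_real_derivative) auto
  then have "((\<lambda>t. cdf law ?a + integral {?a..t} f) has_real_derivative f y) (at y within {?a..?b})"
    by (auto intro!: derivative_eq_intros)
  then have "(cdf law has_real_derivative f y) (at y within {?a..?b})"
  proof (rule has_field_derivative_transform_within[where d = e])
    fix t assume "t \<in> {?a..?b}"
    then show "cdf law ?a + integral {?a..t} f = cdf law t"
      using cdf_diff_support[of ?a t] order_trans[OF _ e(2), of "{?a..t}"] by auto
  qed (use e in auto)
  then show ?thesis using e by (simp add: at_within_Icc_at)
qed

text \<open>A law with a density has no atoms. This covers the end points of the support, where
  \<open>DERIV_cdf\<close> says nothing, and allows the intermediate value theorem on the whole
  line.\<close>

lemma isCont_cdf_law: "isCont (cdf law) x"
proof -
  have "emeasure law {x} = 0"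
    by (subst emeasure_density) (auto intro!: nn_integral_0_iff_AE[THEN iffD2] AE_I'[of "{x}"] split: split_indicator)
  then show ?thesis by (simp add: isCont_cdf measure_def)
qed

text \<open>One point of the support is enough: by openness a short interval next to it, on the side
  of the other point, lies in the support, and the cdf has positive derivative there.\<close>

lemma cdf_strict:
  assumes "x < y" "0 < f x \<or> 0 < f y"
  shows "cdf law x < cdf law y"
proof -
  have strict: "cdf law s < cdf law t" if "s < t" "{s..t} \<subseteq> {x. 0 < f x}" for s t
  proof (rule DERIV_pos_imp_increasing[OF that(1)])
    fix z assume "s \<le> z" "z \<le> t"
    then have "0 < f z" using that by auto
    then show "\<exists>d. (cdf law has_real_derivative d) (at z) \<and> 0 < d"
      using DERIV_cdf by blast
  qed
  from assms(2) show ?thesis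
  proof
    assume "0 < f x"
    then obtain e where e: "e > 0" "{x - e..x + e} \<subseteq> {x. 0 < f x}" by (rule support_nbhd)
    have "cdf law x < cdf law (min y (x + e))" using e assms by (intro strict order_trans[OF _ e(2)]) auto
    also have "\<dots> \<le> cdf law y" by (intro cdf_nondecreasing) auto
    finally show ?thesis .
  next
    assume "0 < f y"
    then obtain e where e: "e > 0" "{y - e..y + e} \<subseteq> {x. 0 < f x}" by (rule support_nbhd)
    have "cdf law x \<le> cdf law (max x (y - e))" by (intro cdf_nondecreasing) auto
    also have "\<dots> < cdf law y" using e assms by (intro strict order_trans[OF _ e(2)]) auto
    finally show ?thesis .
  qed
qed

lemma cdf_in_unit:
  assumes "0 < f y"
  shows "0 < cdf law y" "cdf law y < 1"
proof -
  have "0 \<le> cdf law (y - 1)" by (rule cdf_nonneg)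
  also have "\<dots> < cdf law y" using assms by (intro cdf_strict) auto
  finally show "0 < cdf law y" .
  have "cdf law y < cdf law (y + 1)" using assms by (intro cdf_strict) auto
  also have "\<dots> \<le> 1" by (rule cdf_bounded_prob)
  finally show "cdf law y < 1" .
qed

text \<open>A point outside an interval has the whole interval on one side. Consequently a level
  strictly between 0 and 1 can be attained only inside the support.\<close>

lemma cdf_outside_support:
  assumes "f y = 0"
  shows "cdf law y = 0 \<or> cdf law y = 1"
proof -
  have out: "(\<forall>x. 0 < f x \<longrightarrow> y < x) \<or> (\<forall>x. 0 < f x \<longrightarrow> x < y)"
  proof (rule ccontr)
    assume "\<not> ?thesis"
    then obtain s t where "0 < f s" "s \<le> y" "0 < f t" "y \<le> t" by (force simp: not_less)
    then have "0 < f y" using interval_support unfolding is_interval_1 by blast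
    with assms show False by simp
  qed
  have zero: "f x = 0" if "\<not> 0 < f x" for x using nonneg[of x] that by linarith
  from out show ?thesis
  proof
    assume "\<forall>x. 0 < f x \<longrightarrow> y < x"
    then have "f t = 0" if "t \<le> y" for t using that zero by force
    then have "emeasure law {..y} = 0"
      by (subst emeasure_density) (auto intro!: nn_integral_zero' AE_I2 split: split_indicator)
    then show ?thesis by (simp add: cdf_def measure_def)
  next
    assume "\<forall>x. 0 < f x \<longrightarrow> x < y"
    then have *: "f t = 0" if "t > y" for t using that zero by force
    have "emeasure law {..y} = (\<integral>\<^sup>+x. ennreal (f x) \<partial>lborel)"
      by (subst emeasure_density) (auto intro!: nn_integral_cong simp: * split: split_indicator)
    then show ?thesis by (simp add: cdf_def measure_def nn_integral_eq_1)
  qed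
qed

lemma ex1_quantile:
  assumes "0 < p" "p < 1"
  shows "\<exists>!y. 0 < f y \<and> cdf law y = p"
proof -
  have "\<forall>\<^sub>F x in at_bot. cdf law x < p"
    using cdf_lim_at_bot assms(1) by (rule order_tendstoD)
  then obtain a where a: "cdf law a < p" by (auto simp: eventually_at_bot_linorder)
  have "\<forall>\<^sub>F x in at_top. p < cdf law x"
    using cdf_lim_at_top_prob assms(2) by (rule order_tendstoD)
  then obtain b where b: "p < cdf law b" by (auto simp: eventually_at_top_linorder)
  have "a \<le> b" using cdf_nondecreasing[of b a] a b by linarith
  then obtain y where y: "cdf law y = p"
    using IVT[of "cdf law" a p b] a b isCont_cdf_law by auto
  then have "f y \<noteq> 0" using cdf_outside_support[of y] assms by auto
  then have fy: "0 < f y" using nonneg[of y] by linarith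
  show ?thesis
  proof (rule ex1I[of _ y])
    fix z assume z: "0 < f z \<and> cdf law z = p"
    then show "z = y" using cdf_strict[of z y] cdf_strict[of y z] y fy by (cases z y rule: linorder_cases) auto
  qed (use y fy in auto)
qed

definition quantile :: "real \<Rightarrow> real" where
  "quantile p = (THE y. 0 < f y \<and> cdf law y = p)"

lemma quantile:
  assumes "0 < p" "p < 1"
  shows "0 < f (quantile p)" "cdf law (quantile p) = p"
  by (rule theI'[OF ex1_quantile[OF assms], folded quantile_def, THEN conjunct1])
     (rule theI'[OF ex1_quantile[OF assms], folded quantile_def, THEN conjunct2])

lemma quantile_cdf: "0 < f y \<Longrightarrow> quantile (cdf law y) = y"
  unfolding quantile_def by (intro the1_equality ex1_quantile cdf_in_unit) auto

text \<open>Inverse function theorem on the open support: there \<open>quantile\<close> is a left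
  inverse of the cdf, whose derivative f is nonzero.\<close>

lemma DERIV_quantile:
  assumes "0 < p" "p < 1"
  shows "(quantile has_real_derivative 1 / f (quantile p)) (at p)"
proof -
  note q = quantile[OF assms]
  have "(quantile has_derivative (*) (inverse (f (quantile p)))) (at (cdf law (quantile p)))"
  proof (rule has_derivative_inverse_strong[where S="{x. 0 < f x}" and f="cdf law" and x="quantile p" and g=quantile and f'="(*) (f (quantile p))" and g'="(*) (inverse (f (quantile p)))"])
    show "continuous_on {x. 0 < f x} (cdf law)"
      by (intro continuous_at_imp_continuous_on ballI isCont_cdf_law)
    show "(cdf law has_derivative (*) (f (quantile p))) (at (quantile p))"
      using DERIV_cdf[OF q(1)] by (simp add: has_field_derivative_def)
    show "(*) (f (quantile p)) \<circ> (*) (inverse (f (quantile p))) = id"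
      using q(1) by (intro ext) simp
  qed (use q(1) open_support quantile_cdf in auto)
  then have "(quantile has_real_derivative inverse (f (quantile p))) (at (cdf law (quantile p)))"
    by (simp add: has_field_derivative_def)
  then show ?thesis using q by (simp add: field_simps)
qed

end

lemma interval_density_normal:
  assumes "\<sigma> > 0"
  shows "interval_density (normal_density 0 \<sigma>)"
proof
  have pos: "{x. 0 < normal_density 0 \<sigma> x} = UNIV" using normal_density_pos[OF assms] by auto
  show "(\<integral>\<^sup>+x. ennreal (normal_density 0 \<sigma> x) \<partial>lborel) = 1"
    using assms by (subst nn_integral_eq_integral) auto
  show "continuous_on {x. 0 < normal_density 0 \<sigma> x} (normal_density 0 \<sigma>)"
    unfolding normal_density_def by (intro continuous_intros) (use assms in auto)
qed (auto simp: normal_density_pos[OF assms])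

text \<open>T is the Gaussian cdf followed by the quantile function of f. Its derivative is the
  change of variables equation f(T) T' = \<phi>, with \<phi> the standard normal density.\<close>

lemma (in interval_density) gaussian_transport:
  obtains T where "\<And>x. 0 < f (T x)"
    and "\<And>x. (T has_real_derivative std_normal_density x / f (T x)) (at x)"
    and "continuous_on UNIV (\<lambda>x. std_normal_density x / f (T x))"
    and "T \<in> borel_measurable borel"
    and "distr (density lborel (\<lambda>x. ennreal (std_normal_density x))) borel T = law"
proof -
  interpret G: interval_density std_normal_density by (rule interval_density_normal) simp
  let ?\<Phi> = "cdf G.law"
  define T where "T x = quantile (?\<Phi> x)" for x
  have P: "0 < std_normal_density x" for x by (rule normal_density_pos) simp
  note u = G.cdf_in_unit[OF P]
  have pos: "0 < f (T x)" for x unfolding T_def by (rule quantile(1)[OF u])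
  have der: "(T has_real_derivative std_normal_density x / f (T x)) (at x)" for x
    using DERIV_chain[OF DERIV_quantile[OF u] G.DERIV_cdf[OF P]]
    by (simp add: T_def[abs_def] o_def)
  have contT: "continuous_on UNIV T"
    using der by (intro continuous_at_imp_continuous_on) (auto intro: DERIV_isCont)
  have c: "continuous_on UNIV (\<lambda>x. std_normal_density x / f (T x))"
  proof (intro continuous_on_divide)
    show "continuous_on UNIV std_normal_density" unfolding normal_density_def by (intro continuous_intros) auto
    show "continuous_on UNIV (\<lambda>x. f (T x))"
      using pos by (intro continuous_on_compose2[OF continuous contT]) auto
  qed (metis pos less_irrefl)
  have mT[measurable]: "T \<in> borel_measurable borel" using contT by (rule borel_measurable_continuous_onI)
  \<comment> \<open>Every point of the support has cdf value in (0, 1), and each such value is also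
    a value of the Gaussian cdf. Hence the indicator of \<open>range T\<close> in the substitution
    rule loses no mass of f.\<close>
  have range: "range T = {x. 0 < f x}"
  proof (intro subset_antisym subsetI)
    fix y assume "y \<in> {x. 0 < f x}"
    then have y: "0 < f y" by simp
    have "T (G.quantile (cdf law y)) = y"
      unfolding T_def using cdf_in_unit[OF y] by (simp add: G.quantile quantile_cdf y)
    then show "y \<in> range T" by (metis rangeI)
  qed (use pos in auto)
  have "distr G.law borel T = law"
  proof (rule measure_eqI)
    fix B assume "B \<in> sets (distr G.law borel T)"
    then have [measurable]: "B \<in> sets borel" by simp
    have [measurable]: "T -` B \<in> sets borel" using measurable_sets[OF mT \<open>B \<in> sets borel\<close>] by simp
    have "emeasure (distr G.law borel T) B = (\<integral>\<^sup>+x. ennreal (std_normal_density x) * indicator B (T x) \<partial>lborel)"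
      by (subst emeasure_distr)
         (auto simp: emeasure_density intro!: nn_integral_cong split: split_indicator)
    also have "\<dots> = (\<integral>\<^sup>+x. ennreal ((f (T x) * indicator B (T x)) * (std_normal_density x / f (T x))) \<partial>lborel)"
    proof (intro nn_integral_cong)
      fix x show "ennreal (std_normal_density x) * indicator B (T x)
        = ennreal ((f (T x) * indicator B (T x)) * (std_normal_density x / f (T x)))"
        using pos[of x] by (simp split: split_indicator)
    qed
    also have "\<dots> = (\<integral>\<^sup>+x. ennreal (f x * indicator B x) * indicator (range T) x \<partial>lborel)"
      by (rule nn_integral_substitution_UNIV[OF _ der c]) (auto simp: nonneg)
    also have "\<dots> = (\<integral>\<^sup>+x. ennreal (f x) * indicator B x \<partial>lborel)"
    proof (intro nn_integral_cong)
      fix x show "ennreal (f x * indicator B x) * indicator (range T) x = ennreal (f x) * indicator B x"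
        using nonneg[of x] unfolding range by (auto split: split_indicator)
    qed
    also have "\<dots> = emeasure law B" by (simp add: emeasure_density)
    finally show "emeasure (distr G.law borel T) B = emeasure law B" .
  qed simp
  with that[OF pos der c mT] show thesis .
qed

section \<open>Integrals on product spaces and Gaussian moments\<close>

context pair_prob_space
begin

lemma distr_fst: "distr (M1 \<Otimes>\<^sub>M M2) M1 fst = M1"
  by (rule M2.distr_pair_fst)

lemma distr_snd: "distr (M1 \<Otimes>\<^sub>M M2) M2 snd = M2"
  by (subst distr_pair_swap, subst distr_distr) (auto simp: comp_def split_beta M1.distr_pair_fst)

text \<open>The form \<open>has_bochner_integral\<close> carries integrability and value together,
  so that the mean of a long sum of terms in X and Y can later be assembled summand by
  summand.\<close>

lemma has_bochner_integral_compose_fst: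
  fixes h :: "'a \<Rightarrow> real"
  assumes "has_bochner_integral M1 h r"
  shows "has_bochner_integral (M1 \<Otimes>\<^sub>M M2) (\<lambda>z. h (fst z)) r"
proof -
  have [measurable]: "h \<in> borel_measurable M1"
    using assms by (rule borel_measurable_has_bochner_integral)
  have "has_bochner_integral (distr (M1 \<Otimes>\<^sub>M M2) M1 fst) h r" using assms by (simp add: distr_fst)
  then show ?thesis by (simp add: has_bochner_integral_iff integrable_distr_eq integral_distr)
qed

lemma has_bochner_integral_compose_snd:
  fixes h :: "'b \<Rightarrow> real"
  assumes "has_bochner_integral M2 h r"
  shows "has_bochner_integral (M1 \<Otimes>\<^sub>M M2) (\<lambda>z. h (snd z)) r"
proof -
  have [measurable]: "h \<in> borel_measurable M2"
    using assms by (rule borel_measurable_has_bochner_integral)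
  have "has_bochner_integral (distr (M1 \<Otimes>\<^sub>M M2) M2 snd) h r" using assms by (simp add: distr_snd)
  then show ?thesis by (simp add: has_bochner_integral_iff integrable_distr_eq integral_distr)
qed

end

abbreviation std_normal :: "real measure" where
  "std_normal \<equiv> density lborel (\<lambda>x. ennreal (std_normal_density x))"

lemma std_normal_density_pos: "0 < std_normal_density x"
  by (rule normal_density_pos) simp

lemma ln_std_normal_density: "ln (std_normal_density x) = - ln (sqrt (2 * pi)) - x\<^sup>2 / 2"
  by (simp add: std_normal_density_def ln_mult ln_div)

lemma has_bochner_integral_std_normal:
  assumes "h \<in> borel_measurable borel"
  shows "has_bochner_integral std_normal h r \<longleftrightarrow> has_bochner_integral lborel (\<lambda>x. std_normal_density x * h x) r"
  using assms by (simp add: has_bochner_integral_iff integrable_density integral_density)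

lemma has_bochner_integral_ln_std_normal_density:
  "has_bochner_integral std_normal (\<lambda>x. ln (std_normal_density x)) (- ln (sqrt (2 * pi)) - 1 / 2)"
proof -
  have "has_bochner_integral lborel (\<lambda>x. std_normal_density x * x\<^sup>2) 1"
    using std_normal_moment_even[of 1] by simp
  moreover have "has_bochner_integral lborel std_normal_density 1"
    by (simp add: has_bochner_integral_iff)
  ultimately have "has_bochner_integral lborel
    (\<lambda>x. std_normal_density x * (- ln (sqrt (2 * pi))) - (std_normal_density x * x\<^sup>2) / 2) (1 * (- ln (sqrt (2 * pi))) - 1 / 2)"
    by (intro has_bochner_integral_diff has_bochner_integral_mult_left has_bochner_integral_divide_zero) auto
  then show ?thesis
    by (subst has_bochner_integral_std_normal) (auto simp: ln_std_normal_density algebra_simps)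
qed

text \<open>The logarithm is a quadratic polynomial in the two coordinates. Their squares have mean
  1 and their product has mean 0, so the value depends only on
  \<open>a\<^sup>2 + b\<^sup>2\<close>.\<close>

lemma has_bochner_integral_ln_rotated_normal_density:
  assumes "a\<^sup>2 + b\<^sup>2 = (1::real)"
  shows "has_bochner_integral (std_normal \<Otimes>\<^sub>M std_normal)
    (\<lambda>z. ln (std_normal_density (a * fst z + b * snd z))) (- ln (sqrt (2 * pi)) - 1 / 2)"
proof -
  interpret G: prob_space std_normal by (rule prob_space_normal_density) simp
  interpret GG: pair_prob_space std_normal std_normal ..
  let ?GG = "std_normal \<Otimes>\<^sub>M std_normal"
  have one: "has_bochner_integral std_normal (\<lambda>x. x) 0"
    using std_normal_moment_odd[of 0] by (subst has_bochner_integral_std_normal) auto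
  have two: "has_bochner_integral std_normal (\<lambda>x. x\<^sup>2) 1"
    using std_normal_moment_even[of 1] by (subst has_bochner_integral_std_normal) auto
  note x2 = GG.has_bochner_integral_compose_fst[OF two] and y2 = GG.has_bochner_integral_compose_snd[OF two]
  have xy: "integrable ?GG (\<lambda>z. fst z * snd z)"
  proof (rule Bochner_Integration.integrable_bound)
    show "integrable ?GG (\<lambda>z. (fst z)\<^sup>2 + (snd z)\<^sup>2)"
      using x2 y2 by (auto simp: has_bochner_integral_iff)
    have "\<bar>x * y\<bar> \<le> x\<^sup>2 + y\<^sup>2" for x y :: real
    proof -
      have "2 * \<bar>x * y\<bar> \<le> x\<^sup>2 + y\<^sup>2"
        using sum_squares_bound[of "\<bar>x\<bar>" "\<bar>y\<bar>"] by (simp add: abs_mult)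
      then show ?thesis by linarith
    qed
    then show "AE z in ?GG. norm (fst z * snd z) \<le> norm ((fst z)\<^sup>2 + (snd z)\<^sup>2)" by simp
  qed measurable
  have "integral\<^sup>L ?GG (\<lambda>z. fst z * snd z) = (\<integral>x. \<integral>y. x * y \<partial>std_normal \<partial>std_normal)"
    using GG.integral_fst'[OF xy] by simp
  also have "\<dots> = 0" using one by (simp add: has_bochner_integral_iff)
  finally have xy: "has_bochner_integral ?GG (\<lambda>z. fst z * snd z) 0"
    using xy by (simp add: has_bochner_integral_iff)
  have "has_bochner_integral ?GG
     (\<lambda>z. - ln (sqrt (2 * pi)) - ((a\<^sup>2 / 2) * (fst z)\<^sup>2 + (b\<^sup>2 / 2) * (snd z)\<^sup>2 + (a * b) * (fst z * snd z)))
     (- ln (sqrt (2 * pi)) - ((a\<^sup>2 / 2) * 1 + (b\<^sup>2 / 2) * 1 + (a * b) * 0))"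
  proof (intro has_bochner_integral_diff has_bochner_integral_add has_bochner_integral_mult_right x2 y2 xy)
    show "has_bochner_integral ?GG (\<lambda>z. - ln (sqrt (2 * pi))) (- ln (sqrt (2 * pi)))"
      using GG.prob_space by (simp add: has_bochner_integral_iff)
  qed
  moreover have "- ln (sqrt (2 * pi)) - ((a\<^sup>2 / 2) * 1 + (b\<^sup>2 / 2) * 1 + (a * b) * 0) = - ln (sqrt (2 * pi)) - 1 / 2"
    using assms by (simp add: field_simps)
  ultimately show ?thesis
    using assms by (simp add: ln_std_normal_density power2_sum power_mult_distrib field_simps)
qed

section \<open>The entropy power inequality\<close>

text \<open>In the proof \<open>S\<close> is the sum in Gaussian coordinates and \<open>R\<close>
  the normal density at the first rotated coordinate. \<open>L\<close> bounds ln (p(S) D / R) from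
  below, and p(S) D / R has mean at most 1. With ln y \<le> y - 1 the mean of \<open>L\<close> is
  therefore at most 0; as S has density p, this mean consists of the three entropies and constants,
  which gives the claim.\<close>

theorem entropy_convolution_lower_bound:
  fixes f g p :: "real \<Rightarrow> real" and a b :: real
  assumes f: "interval_density f" and g: "interval_density g"
    and p[measurable]: "p \<in> borel_measurable borel" and p_pos: "\<And>s. 0 < p s"
    and conv: "density lborel f \<star> density lborel g = density lborel p"
    and int_f: "integrable lborel (\<lambda>x. f x * ln (f x))"
    and int_g: "integrable lborel (\<lambda>x. g x * ln (g x))"
    and int_p: "integrable lborel (\<lambda>x. p x * ln (p x))"
    and ab: "0 < a" "0 < b" "a\<^sup>2 + b\<^sup>2 = 1"
  shows "a\<^sup>2 * (- (\<integral>x. f x * ln (f x) \<partial>lborel) - ln a) + b\<^sup>2 * (- (\<integral>x. g x * ln (g x) \<partial>lborel) - ln b)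
    \<le> - (\<integral>x. p x * ln (p x) \<partial>lborel)"
proof -
  interpret F: interval_density f by fact
  interpret G: interval_density g by fact
  interpret N: prob_space std_normal by (rule prob_space_normal_density) simp
  interpret NN: pair_prob_space std_normal std_normal ..
  let ?NN = "std_normal \<Otimes>\<^sub>M std_normal"
  let ?\<phi> = std_normal_density
  note [simp] = std_normal_density_pos
  obtain T where T: "\<And>x. 0 < f (T x)"
    "\<And>x. (T has_real_derivative ?\<phi> x / f (T x)) (at x)"
    "continuous_on UNIV (\<lambda>x. ?\<phi> x / f (T x))"
    and [measurable]: "T \<in> borel_measurable borel"
    and T_distr: "distr std_normal borel T = F.law" using F.gaussian_transport by blast
  obtain U where U: "\<And>x. 0 < g (U x)"
    "\<And>x. (U has_real_derivative ?\<phi> x / g (U x)) (at x)"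
    "continuous_on UNIV (\<lambda>x. ?\<phi> x / g (U x))"
    and [measurable]: "U \<in> borel_measurable borel"
    and U_distr: "distr std_normal borel U = G.law" using G.gaussian_transport by blast
  define t where "t x = ?\<phi> x / f (T x)" for x
  define u where "u x = ?\<phi> x / g (U x)" for x
  have t_pos: "0 < t x" and u_pos: "0 < u x" for x by (simp_all add: t_def u_def T U)
  have t_cont: "continuous_on UNIV t" and u_cont: "continuous_on UNIV u"
    using T(3) U(3) by (simp_all add: t_def[abs_def] u_def[abs_def])
  have [measurable]: "t \<in> borel_measurable borel" "u \<in> borel_measurable borel"
    using t_cont u_cont by (auto intro: borel_measurable_continuous_onI)
  define S where "S z = T (fst z) + U (snd z)" for z
  define D where "D z = a * t (fst z) + b * u (snd z)" for z
  define R where "R z = ?\<phi> (a * fst z + b * snd z)" for z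
  \<comment> \<open>In place of ln D stands the weighted mean of ln (t / a) and ln (u / b). Each
    summand now depends on one Gaussian alone, on S, or on the rotated coordinate, so its mean can
    be evaluated.\<close>
  define L where "L z = ln (p (S z)) + a\<^sup>2 * (ln (t (fst z)) - ln a) + b\<^sup>2 * (ln (u (snd z)) - ln b) - ln (R z)" for z
  have [measurable]: "S \<in> borel_measurable (borel \<Otimes>\<^sub>M borel)" "D \<in> borel_measurable (borel \<Otimes>\<^sub>M borel)"
    "R \<in> borel_measurable (borel \<Otimes>\<^sub>M borel)"
    unfolding S_def[abs_def] D_def[abs_def] R_def[abs_def] by measurable
  have D_pos: "0 < D z" and R_pos: "0 < R z" for z
    using ab t_pos u_pos by (auto simp: D_def R_def intro!: add_pos_pos mult_pos_pos)

  \<comment> \<open>weighted AM-GM for \<open>D = a\<^sup>2 (t/a) + b\<^sup>2 (u/b)\<close>\<close>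
  have L_le: "L z \<le> p (S z) * D z / R z - 1" for z
  proof -
    let ?x = "t (fst z) / a" and ?y = "u (snd z) / b"
    have xy: "0 < ?x" "0 < ?y" using ab t_pos u_pos by auto
    have "ln ?x - ln (D z) \<le> ?x / D z - 1" "ln ?y - ln (D z) \<le> ?y / D z - 1"
      using ln_diff_le[OF xy(1) D_pos[of z]] ln_diff_le[OF xy(2) D_pos[of z]] D_pos[of z] by (simp_all add: diff_divide_distrib)
    then have "a\<^sup>2 * (ln ?x - ln (D z)) + b\<^sup>2 * (ln ?y - ln (D z)) \<le> a\<^sup>2 * (?x / D z - 1) + b\<^sup>2 * (?y / D z - 1)"
      by (intro add_mono mult_left_mono) auto
    also have "\<dots> = (a * t (fst z) + b * u (snd z)) / D z - (a\<^sup>2 + b\<^sup>2)"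
    proof -
      have "a\<^sup>2 * (?x / D z) = a * t (fst z) / D z" "b\<^sup>2 * (?y / D z) = b * u (snd z) / D z"
        using ab by (simp_all add: power2_eq_square)
      then show ?thesis by (simp only: right_diff_distrib add_divide_distrib)
    qed
    also have "\<dots> = 0" using D_pos[of z] ab by (simp add: D_def)
    finally have "a\<^sup>2 * ln ?x + b\<^sup>2 * ln ?y \<le> (a\<^sup>2 + b\<^sup>2) * ln (D z)" by (simp add: algebra_simps)
    moreover have "ln ?x = ln (t (fst z)) - ln a" "ln ?y = ln (u (snd z)) - ln b"
      using ab t_pos u_pos by (simp_all only: ln_divide_pos)
    ultimately have "L z \<le> ln (p (S z)) + ln (D z) - ln (R z)" unfolding L_def using ab by simp
    also have "\<dots> = ln (p (S z) * D z / R z)"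
      by (simp only: ln_divide_pos ln_mult_pos mult_pos_pos p_pos D_pos R_pos)
    also have "\<dots> \<le> p (S z) * D z / R z - 1"
      using p_pos D_pos R_pos by (intro ln_le_minus_one) auto
    finally show ?thesis .
  qed

  have p_mass: "(\<integral>\<^sup>+s. ennreal (p s) \<partial>lborel) = 1"
  proof -
    interpret FG: pair_prob_space F.law G.law ..
    have "prob_space (F.law \<star> G.law)"
      unfolding convolution_def by (rule FG.prob_space_distr) simp
    then have "emeasure (density lborel p) UNIV = 1"
      unfolding conv using prob_space.emeasure_space_1 by fastforce
    then show ?thesis by (simp add: emeasure_density)
  qed
  \<comment> \<open>With \<open>w = a y - b x\<close> fixed, the derivative of \<open>S\<close> along \<open>x\<close> is \<open>D / a\<close>, so the inner integral is at most the mass of \<open>p\<close>.\<close>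
  have psi: "(\<integral>\<^sup>+z. ennreal (p (S z) * D z / R z) \<partial>?NN) \<le> 1"
  proof -
    have "(\<integral>\<^sup>+z. ennreal (p (S z) * D z / R z) \<partial>?NN)
      = (\<integral>\<^sup>+x. \<integral>\<^sup>+y. ennreal (p (S (x, y)) * D (x, y) / R (x, y)) \<partial>std_normal \<partial>std_normal)"
      by (subst N.nn_integral_fst[symmetric]) (auto simp: measurable_split_conv)
    also have "\<dots> = (\<integral>\<^sup>+x. ennreal (?\<phi> x) * (\<integral>\<^sup>+y. ennreal (?\<phi> y) * ennreal (p (S (x, y)) * D (x, y) / R (x, y)) \<partial>lborel) \<partial>lborel)"
      by (subst nn_integral_density, measurable)+
    also have "\<dots> = (\<integral>\<^sup>+x. \<integral>\<^sup>+y. ennreal (?\<phi> x) * (ennreal (?\<phi> y) * ennreal (p (S (x, y)) * D (x, y) / R (x, y))) \<partial>lborel \<partial>lborel)"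
      by (intro nn_integral_cong nn_integral_cmult[symmetric]) measurable
    also have "\<dots> = (\<integral>\<^sup>+x. \<integral>\<^sup>+y. ennreal (p (S (x, y)) * D (x, y) * ?\<phi> (a * y - b * x)) \<partial>lborel \<partial>lborel)"
    proof (intro nn_integral_cong)
      fix x y :: real
      \<comment> \<open>Rotation invariance of the plane Gaussian: the joint density factors also in
        the rotated coordinates. The factor R cancels the denominator.\<close>
      have "?\<phi> x * ?\<phi> y = R (x, y) * ?\<phi> (a * y - b * x)"
      proof -
        have "x\<^sup>2 + y\<^sup>2 = (a\<^sup>2 + b\<^sup>2) * (x\<^sup>2 + y\<^sup>2)" using ab by simp
        also have "\<dots> = (a * x + b * y)\<^sup>2 + (a * y - b * x)\<^sup>2" by algebra
        finally have "- x\<^sup>2 / 2 + - y\<^sup>2 / 2 = - (a * x + b * y)\<^sup>2 / 2 + - (a * y - b * x)\<^sup>2 / 2" by simp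
        then show ?thesis
          unfolding R_def std_normal_density_def by (simp add: mult_exp_exp[symmetric] exp_add[symmetric])
      qed
      then have "?\<phi> x * (?\<phi> y * (p (S (x, y)) * D (x, y) / R (x, y))) = p (S (x, y)) * D (x, y) * ?\<phi> (a * y - b * x)"
        using R_pos[of "(x, y)"] by (simp add: field_simps)
      then show "ennreal (?\<phi> x) * (ennreal (?\<phi> y) * ennreal (p (S (x, y)) * D (x, y) / R (x, y)))
        = ennreal (p (S (x, y)) * D (x, y) * ?\<phi> (a * y - b * x))"
        using p_pos D_pos R_pos by (simp add: ennreal_mult[symmetric] less_imp_le)
    qed
    \<comment> \<open>For fixed x the variable y is replaced by w = a y - b x, that is y = b x / a +
      w / a, with Jacobian 1 / a.\<close>
    also have "\<dots> = (\<integral>\<^sup>+x. \<integral>\<^sup>+w. ennreal (1 / a) * ennreal (p (S (x, b * x / a + 1 / a * w)) * D (x, b * x / a + 1 / a * w) * ?\<phi> w) \<partial>lborel \<partial>lborel)"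
    proof (rule nn_integral_cong)
      fix x :: real
      have w: "a * (b * x / a + 1 / a * w) - b * x = w" for w using ab by (simp add: field_simps)
      have "(\<integral>\<^sup>+y. ennreal (p (S (x, y)) * D (x, y) * ?\<phi> (a * y - b * x)) \<partial>lborel)
        = ennreal \<bar>1 / a\<bar> * (\<integral>\<^sup>+w. ennreal (p (S (x, b * x / a + 1 / a * w)) * D (x, b * x / a + 1 / a * w)
            * ?\<phi> (a * (b * x / a + 1 / a * w) - b * x)) \<partial>lborel)"
        using ab by (intro nn_integral_real_affine) auto
      also have "\<dots> = (\<integral>\<^sup>+w. ennreal (1 / a) * ennreal (p (S (x, b * x / a + 1 / a * w)) * D (x, b * x / a + 1 / a * w) * ?\<phi> w) \<partial>lborel)"
        unfolding w using ab by (subst nn_integral_cmult) auto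
      finally show "(\<integral>\<^sup>+y. ennreal (p (S (x, y)) * D (x, y) * ?\<phi> (a * y - b * x)) \<partial>lborel)
        = (\<integral>\<^sup>+w. ennreal (1 / a) * ennreal (p (S (x, b * x / a + 1 / a * w)) * D (x, b * x / a + 1 / a * w) * ?\<phi> w) \<partial>lborel)" .
    qed
    also have "\<dots> = (\<integral>\<^sup>+w. \<integral>\<^sup>+x. ennreal (1 / a) * ennreal (p (S (x, b * x / a + 1 / a * w)) * D (x, b * x / a + 1 / a * w) * ?\<phi> w) \<partial>lborel \<partial>lborel)"
      by (rule lborel_pair.Fubini') measurable
    also have "\<dots> \<le> (\<integral>\<^sup>+w. ennreal (?\<phi> w) \<partial>lborel)"
    proof (intro nn_integral_mono)
      fix w :: real
      let ?g = "\<lambda>x. T x + U (b * x / a + 1 / a * w)" and ?g' = "\<lambda>x. t x + u (b * x / a + 1 / a * w) * (b / a)"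
      have "(\<integral>\<^sup>+x. ennreal (1 / a) * ennreal (p (S (x, b * x / a + 1 / a * w)) * D (x, b * x / a + 1 / a * w) * ?\<phi> w) \<partial>lborel)
        = (\<integral>\<^sup>+x. ennreal (?\<phi> w) * ennreal (p (?g x) * ?g' x) \<partial>lborel)"
      proof (intro nn_integral_cong)
        fix x
        have "1 / a * (p (S (x, b * x / a + 1 / a * w)) * D (x, b * x / a + 1 / a * w) * ?\<phi> w) = ?\<phi> w * (p (?g x) * ?g' x)"
          using ab by (simp add: S_def D_def field_simps)
        moreover have "0 \<le> ?g' x" using t_pos u_pos ab by (auto intro!: add_nonneg_nonneg simp: less_imp_le)
        ultimately show "ennreal (1 / a) * ennreal (p (S (x, b * x / a + 1 / a * w)) * D (x, b * x / a + 1 / a * w) * ?\<phi> w) = ennreal (?\<phi> w) * ennreal (p (?g x) * ?g' x)"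
          using ab p_pos D_pos by (simp add: ennreal_mult[symmetric] less_imp_le)
      qed
      also have "\<dots> = ennreal (?\<phi> w) * (\<integral>\<^sup>+x. ennreal (p (?g x) * ?g' x) \<partial>lborel)"
        by (rule nn_integral_cmult) measurable
      also have "(\<integral>\<^sup>+x. ennreal (p (?g x) * ?g' x) \<partial>lborel) = (\<integral>\<^sup>+s. ennreal (p s) * indicator (range ?g) s \<partial>lborel)"
      proof (rule nn_integral_substitution_UNIV)
        fix x
        have T': "(T has_real_derivative t x) (at x)" and U': "(U has_real_derivative u x) (at x)" for x
          using T(2) U(2) by (simp_all add: t_def u_def)
        show "(?g has_real_derivative ?g' x) (at x)"
          using ab by (auto intro!: derivative_eq_intros T' DERIV_chain'[where g=U] U')
        show "0 \<le> ?g' x" using t_pos u_pos ab by (auto intro!: add_nonneg_nonneg simp: less_imp_le)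
        show "continuous_on UNIV ?g'"
          using ab by (intro continuous_intros continuous_on_subset[OF t_cont] continuous_on_compose2[OF u_cont]) auto
      qed measurable
      also have "\<dots> \<le> (\<integral>\<^sup>+s. ennreal (p s) \<partial>lborel)"
        by (intro nn_integral_mono) (auto split: split_indicator)
      also have "\<dots> = 1" by (rule p_mass)
      finally show "(\<integral>\<^sup>+x. ennreal (1 / a) * ennreal (p (S (x, b * x / a + 1 / a * w)) * D (x, b * x / a + 1 / a * w) * ?\<phi> w) \<partial>lborel) \<le> ennreal (?\<phi> w)"
        by (simp add: mult_left_mono)
    qed
    also have "\<dots> = 1" by (subst nn_integral_eq_integral) auto
    finally show ?thesis .
  qed

  \<comment> \<open>The mean of ln \<phi> under the standard Gaussian, that is, minus its entropy.
    It enters through ln t, ln u and ln R, and cancels at the end because the weights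
    \<open>a\<^sup>2\<close> and \<open>b\<^sup>2\<close> add up to 1.\<close>
  let ?h0 = "- ln (sqrt (2 * pi)) - 1 / 2"
  have ln_t: "has_bochner_integral std_normal (\<lambda>x. ln (t x)) (?h0 - (\<integral>x. f x * ln (f x) \<partial>lborel))"
  proof -
    \<comment> \<open>By definition ln t = ln \<phi> - ln f(T), and T carries the Gaussian to the
      law of f, so the mean of ln f(T) is the integral of f ln f.\<close>
    have "has_bochner_integral F.law (\<lambda>x. ln (f x)) (\<integral>x. f x * ln (f x) \<partial>lborel)"
      using int_f F.nonneg by (simp add: has_bochner_integral_iff integrable_density integral_density)
    then have "has_bochner_integral std_normal (\<lambda>x. ln (f (T x))) (\<integral>x. f x * ln (f x) \<partial>lborel)"
      unfolding T_distr[symmetric] by (simp add: has_bochner_integral_iff integrable_distr_eq integral_distr)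
    from has_bochner_integral_diff[OF has_bochner_integral_ln_std_normal_density this]
    show ?thesis by (simp only: t_def ln_divide_pos std_normal_density_pos T(1))
  qed
  have ln_u: "has_bochner_integral std_normal (\<lambda>x. ln (u x)) (?h0 - (\<integral>x. g x * ln (g x) \<partial>lborel))"
  proof -
    have "has_bochner_integral G.law (\<lambda>x. ln (g x)) (\<integral>x. g x * ln (g x) \<partial>lborel)"
      using int_g G.nonneg by (simp add: has_bochner_integral_iff integrable_density integral_density)
    then have "has_bochner_integral std_normal (\<lambda>x. ln (g (U x))) (\<integral>x. g x * ln (g x) \<partial>lborel)"
      unfolding U_distr[symmetric] by (simp add: has_bochner_integral_iff integrable_distr_eq integral_distr)
    from has_bochner_integral_diff[OF has_bochner_integral_ln_std_normal_density this]
    show ?thesis by (simp only: u_def ln_divide_pos std_normal_density_pos U(1))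
  qed
  have ln_p: "has_bochner_integral ?NN (\<lambda>z. ln (p (S z))) (\<integral>x. p x * ln (p x) \<partial>lborel)"
  proof -
    have "distr ?NN borel S = distr (distr std_normal borel T \<Otimes>\<^sub>M distr std_normal borel U) borel (\<lambda>(x, y). x + y)"
      by (subst pair_measure_distr)
         (auto simp: distr_distr comp_def split_beta S_def[abs_def] U_distr G.sigma_finite_measure_axioms)
    also have "\<dots> = density lborel p"
      unfolding T_distr U_distr conv[symmetric] convolution_def ..
    finally have S: "distr ?NN borel S = density lborel p" .
    have "has_bochner_integral (density lborel p) (\<lambda>x. ln (p x)) (\<integral>x. p x * ln (p x) \<partial>lborel)"
      using int_p p_pos by (simp add: has_bochner_integral_iff integrable_density integral_density less_imp_le)
    then show ?thesis
      unfolding S[symmetric] by (simp add: has_bochner_integral_iff integrable_distr_eq integral_distr)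
  qed
  have const: "has_bochner_integral std_normal (\<lambda>x. c) c" for c :: real
    using N.prob_space by (simp add: has_bochner_integral_iff)
  have intL: "has_bochner_integral ?NN L
      ((\<integral>x. p x * ln (p x) \<partial>lborel) + a\<^sup>2 * (?h0 - (\<integral>x. f x * ln (f x) \<partial>lborel) - ln a)
       + b\<^sup>2 * (?h0 - (\<integral>x. g x * ln (g x) \<partial>lborel) - ln b) - ?h0)"
    unfolding L_def[abs_def] R_def
    by (intro has_bochner_integral_diff[of ?NN "\<lambda>z. _ z + _ z"] has_bochner_integral_add has_bochner_integral_mult_right ln_p
        NN.has_bochner_integral_compose_fst[OF has_bochner_integral_diff[OF ln_t const]]
        NN.has_bochner_integral_compose_snd[OF has_bochner_integral_diff[OF ln_u const]]
        has_bochner_integral_ln_rotated_normal_density ab)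

  have int_psi: "integrable ?NN (\<lambda>z. p (S z) * D z / R z)"
  proof (rule integrableI_nonneg)
    show "(\<integral>\<^sup>+z. ennreal (p (S z) * D z / R z) \<partial>?NN) < \<infinity>" using psi by (rule order.strict_trans1) simp
  qed (use p_pos D_pos R_pos in \<open>auto simp: less_imp_le\<close>)
  have "integral\<^sup>L ?NN L \<le> integral\<^sup>L ?NN (\<lambda>z. p (S z) * D z / R z - 1)"
    using int_psi intL by (intro integral_mono L_le) (auto simp: has_bochner_integral_iff)
  also have "\<dots> = integral\<^sup>L ?NN (\<lambda>z. p (S z) * D z / R z) - 1"
    using int_psi NN.prob_space by (subst Bochner_Integration.integral_diff) auto
  also have "integral\<^sup>L ?NN (\<lambda>z. p (S z) * D z / R z) \<le> 1"
    using psi p_pos D_pos R_pos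
    by (subst integral_eq_nn_integral) (auto simp: less_imp_le intro!: enn2real_leI)
  finally have "integral\<^sup>L ?NN L \<le> 0" by simp
  then have "(\<integral>x. p x * ln (p x) \<partial>lborel) + a\<^sup>2 * (?h0 - (\<integral>x. f x * ln (f x) \<partial>lborel) - ln a)
       + b\<^sup>2 * (?h0 - (\<integral>x. g x * ln (g x) \<partial>lborel) - ln b) - ?h0 \<le> 0"
    using intL by (simp add: has_bochner_integral_iff)
  moreover have "a\<^sup>2 * ?h0 + b\<^sup>2 * ?h0 = ?h0" using ab(3) by (metis distrib_right mult_1)
  ultimately show ?thesis by (simp only: right_diff_distrib mult_minus_right)
qed

theorem entropy_power_inequality:
  fixes f g p :: "real \<Rightarrow> real"
  assumes f: "interval_density f" and g: "interval_density g"
    and p: "p \<in> borel_measurable borel" "\<And>s. 0 < p s"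
    and conv: "density lborel f \<star> density lborel g = density lborel p"
    and int: "integrable lborel (\<lambda>x. f x * ln (f x))" "integrable lborel (\<lambda>x. g x * ln (g x))"
      "integrable lborel (\<lambda>x. p x * ln (p x))"
    and h: "hf = - (\<integral>x. f x * ln (f x) \<partial>lborel)" "hg = - (\<integral>x. g x * ln (g x) \<partial>lborel)"
  shows "1 / 2 * ln (exp (2 * hf) + exp (2 * hg)) \<le> - (\<integral>x. p x * ln (p x) \<partial>lborel)"
proof -
  define s where "s = exp (2 * hf) + exp (2 * hg)"
  have s: "0 < s" unfolding s_def by (intro add_pos_pos) auto
  \<comment> \<open>The optimal weights: both hf - ln a and hg - ln b become 1/2 ln s, hence so does
    their weighted mean.\<close>
  define a where "a = exp hf / sqrt s"
  define b where "b = exp hg / sqrt s"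
  have ab: "0 < a" "0 < b" using s by (simp_all add: a_def b_def)
  have sq: "a\<^sup>2 + b\<^sup>2 = 1"
    using s by (simp add: a_def b_def power_divide exp_double[symmetric] add_divide_distrib[symmetric] s_def[symmetric])
  have "ln a = hf - 1 / 2 * ln s" "ln b = hg - 1 / 2 * ln s"
    using s by (simp_all add: a_def b_def ln_divide_pos ln_sqrt)
  then have "1 / 2 * ln s = a\<^sup>2 * (hf - ln a) + b\<^sup>2 * (hg - ln b)"
    using sq by (simp add: distrib_right[symmetric])
  also have "\<dots> \<le> - (\<integral>x. p x * ln (p x) \<partial>lborel)"
    unfolding h by (rule entropy_convolution_lower_bound[OF f g p conv int ab sq])
  finally show ?thesis unfolding s_def .
qed

section \<open>Densities squeezed between Gaussians\<close>

lemma convolution_commute: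
  fixes M N :: "real measure"
  assumes "finite_measure M" "finite_measure N"
    and [measurable_cong]: "sets M = sets borel" "sets N = sets borel"
  shows "(M \<star> N) = (N \<star> M)"
proof -
  interpret M: finite_measure M by fact
  interpret N: finite_measure N by fact
  interpret pair_sigma_finite M N ..
  show ?thesis
    unfolding convolution_def
    by (subst distr_pair_swap, subst distr_distr) (auto simp: comp_def split_beta' add.commute)
qed

text \<open>The upper bound gives integrability, the lower one keeps ln q from falling faster than a
  quadratic. The class contains the Gaussians and is closed under convolution with laws of bounded
  support, so it holds both the noise density and the output density.\<close>

definition gaussian_sandwich :: "(real \<Rightarrow> real) \<Rightarrow> bool" where
  "gaussian_sandwich q \<longleftrightarrow> continuous_on UNIV q \<and> (\<exists>c1>0. \<exists>k1>0. \<exists>c2>0. \<exists>k2>0.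
     \<forall>s. c1 * exp (- k1 * s\<^sup>2) \<le> q s \<and> q s \<le> c2 * exp (- k2 * s\<^sup>2))"

lemma gaussian_sandwich_normal_density:
  assumes "\<sigma> > 0"
  shows "gaussian_sandwich (normal_density 0 \<sigma>)"
  unfolding gaussian_sandwich_def
proof (intro conjI exI)
  show "continuous_on UNIV (normal_density 0 \<sigma>)"
    unfolding normal_density_def using assms by (intro continuous_intros) auto
  show "0 < 1 / sqrt (2 * pi * \<sigma>\<^sup>2)" "0 < 1 / (2 * \<sigma>\<^sup>2)" "0 < 1 / sqrt (2 * pi * \<sigma>\<^sup>2)" "0 < 1 / (2 * \<sigma>\<^sup>2)"
    using assms by auto
qed (simp add: normal_density_def)

lemma gaussian_sandwich_pos: "gaussian_sandwich q \<Longrightarrow> 0 < q s"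
  unfolding gaussian_sandwich_def by (meson exp_gt_zero mult_pos_pos order_less_le_trans)

lemma gaussian_sandwich_measurable: "gaussian_sandwich q \<Longrightarrow> q \<in> borel_measurable borel"
  unfolding gaussian_sandwich_def by (auto intro: borel_measurable_continuous_onI)

lemma exp_neg_square_eq_normal_density:
  assumes "k > 0"
  shows "exp (- k * x\<^sup>2) = sqrt (pi / k) * normal_density 0 (sqrt (1 / (2 * k))) x"
  using assms by (simp add: normal_density_def power_divide real_sqrt_divide field_simps)

text \<open>The logarithm of q grows at most quadratically while q decays like a Gaussian, so the
  mass and second moment of a Gaussian dominate the integrand.\<close>

lemma integrable_gaussian_sandwich_entropy:
  assumes q: "gaussian_sandwich q"
  shows "integrable lborel (\<lambda>s. q s * ln (q s))"
proof -
  obtain c1 k1 c2 k2 where c: "c1 > 0" "k1 > 0" "c2 > 0" "k2 > 0"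
    and lo: "\<And>s. c1 * exp (- k1 * s\<^sup>2) \<le> q s" and hi: "\<And>s. q s \<le> c2 * exp (- k2 * s\<^sup>2)"
    using q unfolding gaussian_sandwich_def by blast
  note pos = gaussian_sandwich_pos[OF q] and [measurable] = gaussian_sandwich_measurable[OF q]
  let ?K = "\<bar>ln c1\<bar> + \<bar>ln c2\<bar>" and ?k = "k1 + k2" and ?s = "sqrt (1 / (2 * k2))"
  have bound: "\<bar>ln (q s)\<bar> \<le> ?K + ?k * s\<^sup>2" for s
  proof -
    have "ln (c1 * exp (- k1 * s\<^sup>2)) \<le> ln (q s)" "ln (q s) \<le> ln (c2 * exp (- k2 * s\<^sup>2))"
      using lo[of s] hi[of s] pos[of s] c by (auto intro!: ln_mono mult_pos_pos)
    then have "ln c1 - k1 * s\<^sup>2 \<le> ln (q s)" "ln (q s) \<le> ln c2 - k2 * s\<^sup>2"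
      using c by (simp_all add: ln_mult_pos)
    moreover have "0 \<le> k1 * s\<^sup>2" "0 \<le> k2 * s\<^sup>2" using c by auto
    ultimately show ?thesis by (simp add: algebra_simps)
  qed
  show ?thesis
  proof (rule Bochner_Integration.integrable_bound)
    show "integrable lborel (\<lambda>s. c2 * sqrt (pi / k2) * (?K * normal_density 0 ?s s + ?k * (normal_density 0 ?s s * (s - 0)^2)))"
      using c by (intro integrable_mult_right Bochner_Integration.integrable_add integrable_normal_density
        integrable_normal_moment) auto
    show "AE s in lborel. norm (q s * ln (q s)) \<le> norm (c2 * sqrt (pi / k2) * (?K * normal_density 0 ?s s + ?k * (normal_density 0 ?s s * (s - 0)^2)))"
    proof (intro AE_I2)
      fix s
      have "norm (q s * ln (q s)) = q s * \<bar>ln (q s)\<bar>" using pos[of s] by (simp add: abs_mult)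
      also have "\<dots> \<le> (c2 * exp (- k2 * s\<^sup>2)) * (?K + ?k * s\<^sup>2)"
        using bound[of s] hi[of s] pos[of s] c by (intro mult_mono) (auto simp: less_imp_le)
      also have "\<dots> = c2 * sqrt (pi / k2) * (?K * normal_density 0 ?s s + ?k * (normal_density 0 ?s s * (s - 0)^2))"
        unfolding exp_neg_square_eq_normal_density[OF c(4)] by (simp add: algebra_simps)
      also have "\<dots> \<le> norm \<dots>" by simp
      finally show "norm (q s * ln (q s)) \<le> norm (c2 * sqrt (pi / k2) * (?K * normal_density 0 ?s s + ?k * (normal_density 0 ?s s * (s - 0)^2)))" .
    qed
  qed measurable
qed

text \<open>Shifting by a bounded amount changes only the constants of the two Gaussian bounds, and
  averaging over the shift preserves them. P may be any law of bounded support; the lemma is used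
  once with the uniform noise and once with the channel input.\<close>

lemma gaussian_sandwich_convolution:
  fixes P :: "real measure"
  assumes q: "gaussian_sandwich q"
    and P: "prob_space P" "sets P = sets borel" "AE x in P. \<bar>x\<bar> \<le> B"
  defines "p \<equiv> \<lambda>s. \<integral>x. q (s - x) \<partial>P"
  assumes fin: "finite_measure (density lborel (\<lambda>x. ennreal (q x)))"
  shows "gaussian_sandwich p" "P \<star> density lborel (\<lambda>x. ennreal (q x)) = density lborel (\<lambda>x. ennreal (p x))"
proof -
  interpret P: prob_space P by fact
  note [measurable_cong] = P(2)
  obtain c1 k1 c2 k2 where c: "c1 > 0" "k1 > 0" "c2 > 0" "k2 > 0"
    and lo: "\<And>s. c1 * exp (- k1 * s\<^sup>2) \<le> q s" and hi: "\<And>s. q s \<le> c2 * exp (- k2 * s\<^sup>2)"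
    using q unfolding gaussian_sandwich_def by blast
  note pos = gaussian_sandwich_pos[OF q] and [measurable] = gaussian_sandwich_measurable[OF q]
  have cont: "continuous_on UNIV q" using q by (simp add: gaussian_sandwich_def)
  have bdd: "\<bar>q s\<bar> \<le> c2" for s
  proof -
    have "q s \<le> c2 * exp (- k2 * s\<^sup>2)" by (rule hi)
    also have "\<dots> \<le> c2 * 1" using c by (intro mult_left_mono) auto
    finally show ?thesis using pos[of s] by simp
  qed
  have int: "integrable P (\<lambda>x. q (s - x))" for s
    by (rule P.integrable_const_bound[where B=c2]) (auto simp: bdd)
  have meas_p: "continuous_on UNIV p"
    unfolding continuous_on_sequentially p_def
  proof (intro allI ballI impI, unfold comp_def)
    fix X :: "nat \<Rightarrow> real" and s assume X: "(\<forall>n. X n \<in> UNIV) \<and> X \<longlonglongrightarrow> s"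
    show "(\<lambda>n. \<integral>x. q (X n - x) \<partial>P) \<longlonglongrightarrow> (\<integral>x. q (s - x) \<partial>P)"
    proof (rule integral_dominated_convergence[where w="\<lambda>_. c2"])
      show "AE x in P. (\<lambda>n. q (X n - x)) \<longlonglongrightarrow> q (s - x)"
        using X cont by (auto intro!: isCont_tendsto_compose[where g=q] tendsto_intros simp: continuous_on_eq_continuous_at)
    qed (auto simp: bdd)
  qed
  \<comment> \<open>The two bounds are 0 \<le> (s + x)^2 and 0 \<le> (s - 2x)^2 rearranged. They are
    the origin of the doubled k1, the halved k2 and the factors with \<open>B\<^sup>2\<close>
    below.\<close>
  have sq: "(s - x)\<^sup>2 \<le> 2 * s\<^sup>2 + 2 * B\<^sup>2" "s\<^sup>2 / 2 - B\<^sup>2 \<le> (s - x)\<^sup>2" if "\<bar>x\<bar> \<le> B" for s x :: real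
  proof -
    have x: "x\<^sup>2 \<le> B\<^sup>2" using that by (simp add: abs_le_square_iff[symmetric])
    have "0 \<le> (s + x)\<^sup>2" "0 \<le> (s - 2 * x)\<^sup>2" by simp_all
    then show "(s - x)\<^sup>2 \<le> 2 * s\<^sup>2 + 2 * B\<^sup>2" "s\<^sup>2 / 2 - B\<^sup>2 \<le> (s - x)\<^sup>2"
      using x unfolding power2_eq_square by (simp_all add: algebra_simps)
  qed
  show sand: "gaussian_sandwich p"
    unfolding gaussian_sandwich_def
  proof (intro conjI exI allI meas_p)
    show "0 < c1 * exp (- k1 * (2 * B\<^sup>2))" "0 < k1 * 2" "0 < c2 * exp (k2 * B\<^sup>2)" "0 < k2 / 2"
      using c by auto
    fix s
    have "c1 * exp (- k1 * (2 * B\<^sup>2)) * exp (- (k1 * 2) * s\<^sup>2) = (\<integral>x. c1 * exp (- k1 * (2 * s\<^sup>2 + 2 * B\<^sup>2)) \<partial>P)"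
      by (simp add: P.prob_space exp_add[symmetric] algebra_simps)
    also have "\<dots> \<le> p s"
      unfolding p_def
    proof (rule integral_mono_AE[OF _ int])
      show "AE x in P. c1 * exp (- k1 * (2 * s\<^sup>2 + 2 * B\<^sup>2)) \<le> q (s - x)"
        using P(3)
      proof eventually_elim
        fix x assume "\<bar>x\<bar> \<le> B"
        then have "c1 * exp (- k1 * (2 * s\<^sup>2 + 2 * B\<^sup>2)) \<le> c1 * exp (- k1 * (s - x)\<^sup>2)"
          using c sq by (intro mult_left_mono) auto
        with lo show "c1 * exp (- k1 * (2 * s\<^sup>2 + 2 * B\<^sup>2)) \<le> q (s - x)" by (rule order_trans[rotated])
      qed
    qed simp
    finally show "c1 * exp (- k1 * (2 * B\<^sup>2)) * exp (- (k1 * 2) * s\<^sup>2) \<le> p s" .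
    have "p s \<le> (\<integral>x. c2 * exp (- k2 * (s\<^sup>2 / 2 - B\<^sup>2)) \<partial>P)"
      unfolding p_def
    proof (rule integral_mono_AE[OF int])
      show "AE x in P. q (s - x) \<le> c2 * exp (- k2 * (s\<^sup>2 / 2 - B\<^sup>2))"
        using P(3)
      proof eventually_elim
        fix x assume "\<bar>x\<bar> \<le> B"
        then have "c2 * exp (- k2 * (s - x)\<^sup>2) \<le> c2 * exp (- k2 * (s\<^sup>2 / 2 - B\<^sup>2))"
          using c sq by (intro mult_left_mono) auto
        with hi show "q (s - x) \<le> c2 * exp (- k2 * (s\<^sup>2 / 2 - B\<^sup>2))" by (rule order_trans)
      qed
    qed simp
    also have "\<dots> = c2 * exp (k2 * B\<^sup>2) * exp (- (k2 / 2) * s\<^sup>2)"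
      by (simp add: P.prob_space exp_add[symmetric] algebra_simps)
    finally show "p s \<le> c2 * exp (k2 * B\<^sup>2) * exp (- (k2 / 2) * s\<^sup>2)" .
  qed
  note [measurable] = gaussian_sandwich_measurable[OF sand]
  interpret PL: pair_sigma_finite P lborel ..
  show "P \<star> density lborel (\<lambda>x. ennreal (q x)) = density lborel (\<lambda>x. ennreal (p x))"
  proof (rule measure_eqI)
    fix E assume "E \<in> sets (P \<star> density lborel (\<lambda>x. ennreal (q x)))"
    then have [measurable]: "E \<in> sets borel" by simp
    have "emeasure (P \<star> density lborel (\<lambda>x. ennreal (q x))) E
      = (\<integral>\<^sup>+x. \<integral>\<^sup>+y. indicator E (x + y) \<partial>density lborel (\<lambda>x. ennreal (q x)) \<partial>P)"
      by (rule convolution_emeasure') (use fin P in \<open>auto intro: P.finite_measure_axioms\<close>)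
    also have "\<dots> = (\<integral>\<^sup>+x. \<integral>\<^sup>+s. ennreal (q (s - x)) * indicator E s \<partial>lborel \<partial>P)"
    proof (rule nn_integral_cong)
      fix x
      have "(\<integral>\<^sup>+y. indicator E (x + y) \<partial>density lborel (\<lambda>x. ennreal (q x))) = (\<integral>\<^sup>+y. ennreal (q y) * indicator E (x + y) \<partial>lborel)"
        by (rule nn_integral_density) measurable
      also have "\<dots> = ennreal \<bar>1\<bar> * (\<integral>\<^sup>+s. ennreal (q (- x + 1 * s)) * indicator E (x + (- x + 1 * s)) \<partial>lborel)"
        by (rule nn_integral_real_affine) auto
      finally show "(\<integral>\<^sup>+y. indicator E (x + y) \<partial>density lborel (\<lambda>x. ennreal (q x))) = (\<integral>\<^sup>+s. ennreal (q (s - x)) * indicator E s \<partial>lborel)"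
        by simp
    qed
    also have "\<dots> = (\<integral>\<^sup>+s. \<integral>\<^sup>+x. ennreal (q (s - x)) * indicator E s \<partial>P \<partial>lborel)"
      by (rule PL.Fubini'[symmetric]) measurable
    also have "\<dots> = (\<integral>\<^sup>+s. ennreal (p s) * indicator E s \<partial>lborel)"
    proof (rule nn_integral_cong)
      fix s
      have "(\<integral>\<^sup>+x. ennreal (q (s - x)) * indicator E s \<partial>P) = (\<integral>\<^sup>+x. ennreal (q (s - x)) \<partial>P) * indicator E s"
        by (rule nn_integral_multc) measurable
      also have "(\<integral>\<^sup>+x. ennreal (q (s - x)) \<partial>P) = ennreal (p s)"
        unfolding p_def by (rule nn_integral_eq_integral[OF int]) (auto simp: pos less_imp_le)
      finally show "(\<integral>\<^sup>+x. ennreal (q (s - x)) * indicator E s \<partial>P) = ennreal (p s) * indicator E s" .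
    qed
    also have "\<dots> = emeasure (density lborel (\<lambda>x. ennreal (p x))) E"
      by (simp add: emeasure_density)
    finally show "emeasure (P \<star> density lborel (\<lambda>x. ennreal (q x))) E = emeasure (density lborel (\<lambda>x. ennreal (p x))) E" .
  qed simp
qed

section \<open>Mutual information of an additive channel\<close>

text \<open>Even if P has no density, the pair (X, Y) has the density g(y - x) / p(y) with respect
  to the product of its marginals: conditional output density over output density. The divergence is
  the mean of its logarithm and splits into the means of ln g(Z) and ln p(Y), both finite.\<close>

lemma channel_mutual_information_eq:
  fixes P :: "real measure" and g p :: "real \<Rightarrow> real"
  assumes P: "prob_space P" "sets P = sets borel"
    and [measurable]: "g \<in> borel_measurable borel" "p \<in> borel_measurable borel"
    and g: "\<And>x. 0 < g x" "prob_space (density lborel (\<lambda>x. ennreal (g x)))"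
    and p: "\<And>x. 0 < p x"
    and conv: "P \<star> density lborel (\<lambda>x. ennreal (g x)) = density lborel (\<lambda>x. ennreal (p x))"
    and int_g: "integrable lborel (\<lambda>x. g x * ln (g x))"
    and int_p: "integrable lborel (\<lambda>x. p x * ln (p x))"
  shows "channel_mutual_information P (density lborel (\<lambda>x. ennreal (g x)))
    = (\<integral>x. g x * ln (g x) \<partial>lborel) - (\<integral>x. p x * ln (p x) \<partial>lborel)"
proof -
  let ?N = "density lborel (\<lambda>x. ennreal (g x))" and ?Y = "density lborel (\<lambda>x. ennreal (p x))"
  interpret P: prob_space P by fact
  interpret N: prob_space ?N by fact
  interpret PN: pair_prob_space P ?N ..
  note [measurable_cong] = P(2)
  have Y: "distr (P \<Otimes>\<^sub>M ?N) borel (\<lambda>(x, z). x + z) = ?Y"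
    using conv by (simp add: convolution_def)
  have "prob_space (distr (P \<Otimes>\<^sub>M ?N) borel (\<lambda>(x, z). x + z))"
    by (rule PN.prob_space_distr) simp
  then interpret Y: prob_space ?Y unfolding Y .
  interpret PY: pair_prob_space P ?Y ..
  have fst: "distr (P \<Otimes>\<^sub>M ?N) borel fst = P"
    using PN.distr_fst P(2) by (simp cong: distr_cong)
  define r where "r w = g (snd w - fst w) / p (snd w)" for w
  have [measurable]: "r \<in> borel_measurable (borel \<Otimes>\<^sub>M borel)" unfolding r_def[abs_def] by measurable
  have r: "0 < r w" for w using g p by (simp add: r_def)
  let ?J = "distr (P \<Otimes>\<^sub>M ?N) (borel \<Otimes>\<^sub>M borel) (\<lambda>w. (fst w, case w of (x, z) \<Rightarrow> x + z))"
  have J: "?J = density (P \<Otimes>\<^sub>M ?Y) (\<lambda>w. ennreal (r w))"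
  proof (rule measure_eqI)
    show "sets ?J = sets (density (P \<Otimes>\<^sub>M ?Y) (\<lambda>w. ennreal (r w)))"
      using P(2) by (simp cong: sets_pair_measure_cong)
    fix E assume "E \<in> sets ?J"
    then have E[measurable]: "E \<in> sets (borel \<Otimes>\<^sub>M borel)" by simp
    have "emeasure ?J E = (\<integral>\<^sup>+w. indicator E w \<partial>?J)" by simp
    also have "\<dots> = (\<integral>\<^sup>+w. indicator E (fst w, fst w + snd w) \<partial>(P \<Otimes>\<^sub>M ?N))"
      by (subst nn_integral_distr) (auto simp: split_beta')
    also have "\<dots> = (\<integral>\<^sup>+x. \<integral>\<^sup>+z. indicator E (x, x + z) \<partial>?N \<partial>P)"
      by (subst N.nn_integral_fst[symmetric]) auto
    also have "\<dots> = (\<integral>\<^sup>+x. \<integral>\<^sup>+y. ennreal (r (x, y)) * indicator E (x, y) \<partial>?Y \<partial>P)"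
    proof (rule nn_integral_cong)
      fix x
      have "(\<integral>\<^sup>+z. indicator E (x, x + z) \<partial>?N) = (\<integral>\<^sup>+z. ennreal (g z) * indicator E (x, x + z) \<partial>lborel)"
        by (rule nn_integral_density) measurable
      also have "\<dots> = ennreal \<bar>1\<bar> * (\<integral>\<^sup>+y. ennreal (g (- x + 1 * y)) * indicator E (x, x + (- x + 1 * y)) \<partial>lborel)"
        by (rule nn_integral_real_affine) auto
      also have "\<dots> = (\<integral>\<^sup>+y. ennreal (p y) * (ennreal (r (x, y)) * indicator E (x, y)) \<partial>lborel)"
      proof -
        have "ennreal (g (y - x)) = ennreal (p y) * ennreal (r (x, y))" for y
          using g p[of y] r[of "(x, y)"] by (subst ennreal_mult[symmetric]) (auto simp: r_def less_imp_le)
        then show ?thesis by (simp add: mult.assoc)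
      qed
      also have "\<dots> = (\<integral>\<^sup>+y. ennreal (r (x, y)) * indicator E (x, y) \<partial>?Y)"
        by (rule nn_integral_density[symmetric]) measurable
      finally show "(\<integral>\<^sup>+z. indicator E (x, x + z) \<partial>?N) = (\<integral>\<^sup>+y. ennreal (r (x, y)) * indicator E (x, y) \<partial>?Y)" .
    qed
    also have "\<dots> = (\<integral>\<^sup>+w. ennreal (r w) * indicator E w \<partial>(P \<Otimes>\<^sub>M ?Y))"
      by (subst Y.nn_integral_fst[symmetric]) auto
    also have "\<dots> = emeasure (density (P \<Otimes>\<^sub>M ?Y) (\<lambda>w. ennreal (r w))) E"
      by (rule emeasure_density[symmetric]) measurable
    finally show "emeasure ?J E = emeasure (density (P \<Otimes>\<^sub>M ?Y) (\<lambda>w. ennreal (r w))) E" .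
  qed
  have "channel_mutual_information P ?N = KL_divergence (exp 1) (P \<Otimes>\<^sub>M ?Y) ?J"
    unfolding channel_mutual_information_def PN.mutual_information_def fst Y ..
  also have "\<dots> = (\<integral>w. r w * log (exp 1) (r w) \<partial>(P \<Otimes>\<^sub>M ?Y))"
    unfolding J by (rule PY.KL_density) (auto simp: r less_imp_le)
  also have "\<dots> = (\<integral>w. r w * ln (r w) \<partial>(P \<Otimes>\<^sub>M ?Y))" by (simp add: log_def)
  also have "\<dots> = (\<integral>w. ln (r w) \<partial>?J)"
    unfolding J by (subst integral_real_density) (auto simp: r less_imp_le)
  \<comment> \<open>In the original coordinates the output minus the input is the noise z, so g is
    evaluated at z alone.\<close>
  also have "\<dots> = (\<integral>w. ln (g (snd w)) - ln (p (fst w + snd w)) \<partial>(P \<Otimes>\<^sub>M ?N))"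
    by (subst integral_distr) (auto simp: r_def split_beta' ln_divide_pos g p)
  also have "\<dots> = (\<integral>x. g x * ln (g x) \<partial>lborel) - (\<integral>x. p x * ln (p x) \<partial>lborel)"
  proof -
    have "has_bochner_integral ?N (\<lambda>x. ln (g x)) (\<integral>x. g x * ln (g x) \<partial>lborel)"
      using int_g g by (simp add: has_bochner_integral_iff integrable_density integral_density less_imp_le)
    from PN.has_bochner_integral_compose_snd[OF this]
    have 1: "has_bochner_integral (P \<Otimes>\<^sub>M ?N) (\<lambda>w. ln (g (snd w))) (\<integral>x. g x * ln (g x) \<partial>lborel)" .
    have "has_bochner_integral ?Y (\<lambda>x. ln (p x)) (\<integral>x. p x * ln (p x) \<partial>lborel)"
      using int_p p by (simp add: has_bochner_integral_iff integrable_density integral_density less_imp_le)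
    then have 2: "has_bochner_integral (P \<Otimes>\<^sub>M ?N) (\<lambda>w. ln (p (fst w + snd w))) (\<integral>x. p x * ln (p x) \<partial>lborel)"
      unfolding Y[symmetric] by (simp add: has_bochner_integral_iff integrable_distr_eq integral_distr split_beta')
    show ?thesis using has_bochner_integral_diff[OF 1 2] by (simp add: has_bochner_integral_iff)
  qed
  finally show ?thesis .
qed

section \<open>Entropy maximization under amplitude and power constraints\<close>

text \<open>The normalizing constant of the truncated Gaussian. The parameter \<mu> is the Lagrange
  multiplier of the power constraint, and \<mu> = 0 is the uniform law.\<close>

definition trunc_mass :: "real \<Rightarrow> real \<Rightarrow> real" where
  "trunc_mass A \<mu> = integral {-A..A} (\<lambda>x. exp (- \<mu> * x\<^sup>2))"

definition trunc_moment :: "real \<Rightarrow> real \<Rightarrow> real" where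
  "trunc_moment A \<mu> = integral {-A..A} (\<lambda>x. x\<^sup>2 * exp (- \<mu> * x\<^sup>2)) / trunc_mass A \<mu>"

text \<open>The strict inequality makes the support open, as \<open>interval_density\<close>
  demands.\<close>

definition trunc_density :: "real \<Rightarrow> real \<Rightarrow> real \<Rightarrow> real" where
  "trunc_density A \<mu> x = (if \<bar>x\<bar> < A then exp (- \<mu> * x\<^sup>2) / trunc_mass A \<mu> else 0)"

lemma trunc_mass_pos:
  assumes "A > 0" "\<mu> \<ge> 0"
  shows "0 < trunc_mass A \<mu>"
proof -
  have "0 < 2 * A * exp (- \<mu> * A\<^sup>2)" using assms by simp
  also have "\<dots> = integral {-A..A} (\<lambda>x. exp (- \<mu> * A\<^sup>2))" using assms by simp
  also have "\<dots> \<le> trunc_mass A \<mu>"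
    unfolding trunc_mass_def
  proof (rule integral_le)
    fix x assume "x \<in> {-A..A}"
    then have "x\<^sup>2 \<le> A\<^sup>2" by (intro abs_le_square_iff[THEN iffD1]) auto
    then show "exp (- \<mu> * A\<^sup>2) \<le> exp (- \<mu> * x\<^sup>2)" using assms by (simp add: mult_left_mono)
  qed (auto intro!: integrable_continuous_real continuous_intros)
  finally show ?thesis .
qed

text \<open>A bridge between two integrals: the Henstock integral over the closed interval gives
  access to the fundamental theorem of calculus and to continuity in \<mu>, while laws need the
  Lebesgue integral. The two end points are a null set.\<close>

lemma has_bochner_integral_centered_interval:
  fixes h :: "real \<Rightarrow> real"
  assumes h: "continuous_on {-A..A} h"
  shows "has_bochner_integral lborel (\<lambda>x. if \<bar>x\<bar> < A then h x else 0) (integral {-A..A} h)"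
proof -
  have int: "set_integrable lborel {-A..A} h"
    unfolding set_integrable_def by (rule borel_integrable_compact[OF _ h]) simp
  then have *: "has_bochner_integral lborel (\<lambda>x. indicator {-A..A} x *\<^sub>R h x) (integral {-A..A} h)"
    using set_borel_integral_eq_integral(2)[OF int]
    by (simp add: has_bochner_integral_iff set_integrable_def set_lebesgue_integral_def)
  have eq: "(\<lambda>x. if \<bar>x\<bar> < A then h x else 0) = (\<lambda>x. indicator {-A<..<A} x *\<^sub>R (indicator {-A..A} x *\<^sub>R h x :: real))"
    by (auto simp: fun_eq_iff abs_less_iff split: split_indicator)
  have "(\<lambda>x. if \<bar>x\<bar> < A then h x else 0) \<in> borel_measurable lborel"
    unfolding eq
    by (rule borel_measurable_scaleR[OF borel_measurable_indicator borel_measurable_has_bochner_integral[OF *]]) simp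
  moreover have "AE x in lborel. (if \<bar>x\<bar> < A then h x else 0) = indicator {-A..A} x *\<^sub>R h x"
  proof (rule AE_I'[of "{-A, A}"])
    show "{-A, A} \<in> null_sets lborel" by (intro finite_imp_null_set_lborel) auto
  qed (auto split: split_indicator_asm if_splits)
  ultimately show ?thesis
    using * by (subst has_bochner_integral_cong_AE) (auto dest: borel_measurable_has_bochner_integral)
qed

context
  fixes A \<mu> :: real
  assumes A: "A > 0" and \<mu>: "\<mu> \<ge> 0"
begin

private lemma mass_pos: "0 < trunc_mass A \<mu>" using A \<mu> by (rule trunc_mass_pos)

lemma trunc_density_nonneg: "0 \<le> trunc_density A \<mu> x"
  using mass_pos by (simp add: trunc_density_def)

lemma has_bochner_integral_trunc_density: "has_bochner_integral lborel (trunc_density A \<mu>) 1"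
proof -
  have "has_bochner_integral lborel (\<lambda>x. (if \<bar>x\<bar> < A then exp (- \<mu> * x\<^sup>2) else 0) / trunc_mass A \<mu>)
      (trunc_mass A \<mu> / trunc_mass A \<mu>)"
    unfolding trunc_mass_def
    by (intro has_bochner_integral_divide_zero has_bochner_integral_centered_interval continuous_intros)
  moreover have "(\<lambda>x. (if \<bar>x\<bar> < A then exp (- \<mu> * x\<^sup>2) else 0) / trunc_mass A \<mu>) = trunc_density A \<mu>"
    by (auto simp: trunc_density_def)
  ultimately show ?thesis using mass_pos by simp
qed

lemma trunc_density_measurable[measurable]: "trunc_density A \<mu> \<in> borel_measurable borel"
  using borel_measurable_has_bochner_integral[OF has_bochner_integral_trunc_density] by simp

lemma has_bochner_integral_trunc_density_square:
  "has_bochner_integral lborel (\<lambda>x. trunc_density A \<mu> x * x\<^sup>2) (trunc_moment A \<mu>)"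
proof -
  have "has_bochner_integral lborel (\<lambda>x. (if \<bar>x\<bar> < A then x\<^sup>2 * exp (- \<mu> * x\<^sup>2) else 0) / trunc_mass A \<mu>)
      (trunc_moment A \<mu>)"
    unfolding trunc_moment_def
    by (intro has_bochner_integral_divide_zero has_bochner_integral_centered_interval continuous_intros)
  moreover have "(\<lambda>x. (if \<bar>x\<bar> < A then x\<^sup>2 * exp (- \<mu> * x\<^sup>2) else 0) / trunc_mass A \<mu>) = (\<lambda>x. trunc_density A \<mu> x * x\<^sup>2)"
    by (auto simp: trunc_density_def)
  ultimately show ?thesis by simp
qed

lemma has_bochner_integral_trunc_density_ln:
  "has_bochner_integral lborel (\<lambda>x. trunc_density A \<mu> x * ln (trunc_density A \<mu> x))
     (- (ln (trunc_mass A \<mu>) + \<mu> * trunc_moment A \<mu>))"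
proof -
  have "trunc_density A \<mu> x * ln (trunc_density A \<mu> x)
    = - (trunc_density A \<mu> x * ln (trunc_mass A \<mu>) + \<mu> * (trunc_density A \<mu> x * x\<^sup>2))" for x
    using mass_pos by (simp add: trunc_density_def ln_divide_pos field_simps)
  moreover have "has_bochner_integral lborel
     (\<lambda>x. - (trunc_density A \<mu> x * ln (trunc_mass A \<mu>) + \<mu> * (trunc_density A \<mu> x * x\<^sup>2)))
     (- (1 * ln (trunc_mass A \<mu>) + \<mu> * trunc_moment A \<mu>))"
    by (intro has_bochner_integral_minus has_bochner_integral_add has_bochner_integral_mult_left has_bochner_integral_mult_right
        has_bochner_integral_trunc_density has_bochner_integral_trunc_density_square)
  ultimately show ?thesis by simp
qed

lemma interval_density_trunc_density: "interval_density (trunc_density A \<mu>)"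
proof
  have supp: "{x. 0 < trunc_density A \<mu> x} = {-A<..<A}"
    using mass_pos by (auto simp: trunc_density_def abs_less_iff)
  show "open {x. 0 < trunc_density A \<mu> x}" "is_interval {x. 0 < trunc_density A \<mu> x}"
    unfolding supp by (auto simp: is_interval_def)
  have "continuous_on {-A<..<A} (\<lambda>x. exp (- \<mu> * x\<^sup>2) / trunc_mass A \<mu>)"
    using mass_pos by (intro continuous_intros) auto
  then show "continuous_on {x. 0 < trunc_density A \<mu> x} (trunc_density A \<mu>)"
    unfolding supp by (rule continuous_on_eq) (auto simp: trunc_density_def abs_less_iff)
  show "(\<integral>\<^sup>+x. ennreal (trunc_density A \<mu> x) \<partial>lborel) = 1"
    using has_bochner_integral_trunc_density trunc_density_nonneg
    by (subst nn_integral_eq_integral) (auto simp: has_bochner_integral_iff)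
qed (auto intro: trunc_density_nonneg)

lemma admissible_trunc_density:
  assumes "trunc_moment A \<mu> \<le> P0"
  shows "density lborel (\<lambda>x. ennreal (trunc_density A \<mu> x)) \<in> admissible_inputs A P0"
proof -
  interpret interval_density "trunc_density A \<mu>" by (rule interval_density_trunc_density)
  have "AE x in law. \<bar>x\<bar> \<le> A"
    by (subst AE_density) (auto simp: trunc_density_def intro!: AE_I2)
  moreover have "(\<integral>x. x\<^sup>2 \<partial>law) = trunc_moment A \<mu>"
    using has_bochner_integral_trunc_density_square trunc_density_nonneg
    by (subst integral_real_density) (auto simp: has_bochner_integral_iff)
  ultimately show ?thesis
    using assms prob_space_axioms by (simp add: admissible_inputs_def)
qed

lemma differential_entropy_trunc_density:
  "differential_entropy (density lborel (\<lambda>x. ennreal (trunc_density A \<mu> x)))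
     = ereal (ln (trunc_mass A \<mu>) + \<mu> * trunc_moment A \<mu>)"
  using has_bochner_integral_trunc_density_ln trunc_density_nonneg
  by (subst differential_entropy_density) (auto simp: has_bochner_integral_iff)

text \<open>Gibbs' inequality against \<open>trunc_density A \<mu>\<close>, whose logarithm is affine in \<open>x\<^sup>2\<close>.\<close>

lemma differential_entropy_le:
  assumes P: "P \<in> admissible_inputs A P0"
  shows "differential_entropy P \<le> ereal (ln (trunc_mass A \<mu>) + \<mu> * P0)"
proof (cases "\<exists>h\<in>borel_measurable lborel. density lborel h = P")
  case False
  then show ?thesis by (simp add: differential_entropy_def)
next
  case ex: True
  then obtain h where h: "h \<in> borel_measurable lborel" "density lborel h = P" by blast
  have "prob_space P" and AE_P: "AE x in P. \<bar>x\<bar> \<le> A" and mom: "(\<integral>x. x\<^sup>2 \<partial>P) \<le> P0"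
    and setsP: "sets P = sets borel"
    using P by (auto simp: admissible_inputs_def)
  then interpret P: prob_space P by simp
  \<comment> \<open>The entropy is defined through the Radon-Nikodym derivative, so this version of
    the density is used. It is finite almost everywhere because P is sigma-finite, and passing to
    real values loses nothing.\<close>
  define f where "f x = enn2real (RN_deriv lborel P x)" for x
  have [measurable]: "f \<in> borel_measurable borel" unfolding f_def[abs_def] by measurable
  have f_nonneg: "0 \<le> f x" for x by (simp add: f_def)
  have RN: "density lborel (RN_deriv lborel P) = P"
    using density_RN_deriv_density[OF h(1)] h(2) by simp
  have "AE x in lborel. RN_deriv lborel P x \<noteq> \<infinity>"
  proof (rule sigma_finite_measure.RN_deriv_finite[OF sigma_finite_lborel])
    show "sigma_finite_measure P" ..
    show "absolutely_continuous lborel P" using absolutely_continuousI_density[OF h(1)] h(2) by simp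
  qed (simp add: setsP)
  then have "AE x in lborel. RN_deriv lborel P x = ennreal (f x)"
    by eventually_elim (simp add: f_def less_top)
  then have Pf: "P = density lborel (\<lambda>x. ennreal (f x))"
    by (subst RN[symmetric], intro density_cong) auto
  have supp: "AE x in lborel. 0 < f x \<longrightarrow> \<bar>x\<bar> \<le> A"
    using AE_P unfolding Pf by (subst (asm) AE_density) auto
  have "(\<integral>\<^sup>+x. ennreal (f x) \<partial>lborel) = 1"
    using P.emeasure_space_1 unfolding Pf by (simp add: emeasure_density)
  then have f1: "has_bochner_integral lborel f 1"
    by (intro has_bochner_integral_nn_integral) (auto simp: f_nonneg)
  have "integrable lborel (\<lambda>x. f x * x\<^sup>2)"
  proof (rule Bochner_Integration.integrable_bound)
    show "integrable lborel (\<lambda>x. A\<^sup>2 * f x)" using f1 by (auto simp: has_bochner_integral_iff)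
    show "AE x in lborel. norm (f x * x\<^sup>2) \<le> norm (A\<^sup>2 * f x)"
      using supp
    proof eventually_elim
      fix x assume x: "0 < f x \<longrightarrow> \<bar>x\<bar> \<le> A"
      show "norm (f x * x\<^sup>2) \<le> norm (A\<^sup>2 * f x)"
      proof (cases "f x = 0")
        case False
        then have "\<bar>x\<bar> \<le> A" using x f_nonneg[of x] by simp
        then have "x\<^sup>2 \<le> A\<^sup>2" using A by (intro abs_le_square_iff[THEN iffD1]) auto
        then show ?thesis using f_nonneg[of x] by (simp add: mult.commute mult_left_mono)
      qed simp
    qed
  qed measurable
  moreover have "(\<integral>x. x\<^sup>2 \<partial>P) = (\<integral>x. f x * x\<^sup>2 \<partial>lborel)"
    unfolding Pf by (rule integral_real_density) (auto simp: f_nonneg)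
  ultimately have f2: "has_bochner_integral lborel (\<lambda>x. f x * x\<^sup>2) (\<integral>x. x\<^sup>2 \<partial>P)"
    by (simp add: has_bochner_integral_iff)
  \<comment> \<open>With q the truncated Gaussian density, ln q - ln f \<le> q / f - 1 gives - f ln
    f \<le> - f ln q + q - f, and \<open>H\<close> is the right side written out. The masses of q
    and f cancel in its integral.\<close>
  define H where "H x = f x * ln (trunc_mass A \<mu>) + \<mu> * (f x * x\<^sup>2) + trunc_density A \<mu> x - f x" for x
  have H: "has_bochner_integral lborel H (1 * ln (trunc_mass A \<mu>) + \<mu> * (\<integral>x. x\<^sup>2 \<partial>P) + 1 - 1)"
    unfolding H_def[abs_def]
    by (intro has_bochner_integral_diff[of lborel "\<lambda>x. _ x + _ x"] has_bochner_integral_add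
        has_bochner_integral_mult_left has_bochner_integral_mult_right f1 f2 has_bochner_integral_trunc_density)
  \<comment> \<open>At the end points q is 0 while f may be positive, so the pointwise bound is
    claimed only away from them.\<close>
  have ends: "AE x in lborel. \<bar>x\<bar> \<noteq> A"
    by (rule AE_I'[of "{-A, A}"]) (auto intro: finite_imp_null_set_lborel)
  have le: "AE x in lborel. - (f x * ln (f x)) \<le> H x"
    using supp ends
  proof eventually_elim
    fix x assume x: "0 < f x \<longrightarrow> \<bar>x\<bar> \<le> A" "\<bar>x\<bar> \<noteq> A"
    show "- (f x * ln (f x)) \<le> H x"
    proof (cases "f x = 0")
      case True
      then show ?thesis using trunc_density_nonneg[of x] by (simp add: H_def)
    next
      case False
      then have fx: "0 < f x" using f_nonneg[of x] by simp
      then have "\<bar>x\<bar> < A" using x by simp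
      then have q: "trunc_density A \<mu> x = exp (- \<mu> * x\<^sup>2) / trunc_mass A \<mu>" by (simp add: trunc_density_def)
      then have qpos: "0 < trunc_density A \<mu> x" using mass_pos by simp
      have lnq: "ln (trunc_density A \<mu> x) = - \<mu> * x\<^sup>2 - ln (trunc_mass A \<mu>)"
        unfolding q using mass_pos by (simp add: ln_divide_pos)
      have "f x * (ln (trunc_density A \<mu> x) - ln (f x)) \<le> f x * ((trunc_density A \<mu> x - f x) / f x)"
        using ln_diff_le[OF qpos fx] fx by (intro mult_left_mono) auto
      also have "\<dots> = trunc_density A \<mu> x - f x" using fx by simp
      finally show ?thesis by (simp add: H_def lnq algebra_simps)
    qed
  qed
  have int_le: "ln (trunc_mass A \<mu>) + \<mu> * (\<integral>x. x\<^sup>2 \<partial>P) \<le> ln (trunc_mass A \<mu>) + \<mu> * P0"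
    using mom \<mu> by (simp add: mult_left_mono)
  \<comment> \<open>The positive part of - f ln f lies below an integrable function, so the
    difference defining the entropy is not of the form infinity minus infinity. If the negative part
    diverges, the entropy is minus infinity and the bound is trivial.\<close>
  have "(\<integral>\<^sup>+x. ennreal (- (f x * ln (f x))) \<partial>lborel) \<le> (\<integral>\<^sup>+x. ennreal (norm (H x)) \<partial>lborel)"
    by (intro nn_integral_mono_AE, use le in eventually_elim) (auto intro!: ennreal_leI)
  also have "\<dots> < \<infinity>" using H by (auto simp: has_bochner_integral_iff integrable_iff_bounded)
  finally have fin: "(\<integral>\<^sup>+x. ennreal (- (f x * ln (f x))) \<partial>lborel) \<noteq> \<infinity>" by simp
  show ?thesis
  proof (cases "(\<integral>\<^sup>+x. ennreal (f x * ln (f x)) \<partial>lborel) = \<infinity>")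
    case True
    have "differential_entropy P = enn2ereal (\<integral>\<^sup>+x. ennreal (- (f x * ln (f x))) \<partial>lborel) - \<infinity>"
      using True ex by (simp add: differential_entropy_def f_def)
    also have "\<dots> = - \<infinity>" using fin by (cases "\<integral>\<^sup>+x. ennreal (- (f x * ln (f x))) \<partial>lborel") (auto simp: enn2ereal_ennreal)
    finally show ?thesis by simp
  next
    case False
    then have int: "integrable lborel (\<lambda>x. f x * ln (f x))"
      using fin by (simp add: real_integrable_def)
    have "differential_entropy P = ereal (- (\<integral>x. f x * ln (f x) \<partial>lborel))"
      unfolding Pf by (rule differential_entropy_density) (auto simp: f_nonneg int)
    also have "- (\<integral>x. f x * ln (f x) \<partial>lborel) = (\<integral>x. - (f x * ln (f x)) \<partial>lborel)" by simp
    also have "\<dots> \<le> integral\<^sup>L lborel H"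
      using int H le by (intro integral_mono_AE) (auto simp: has_bochner_integral_iff)
    also have "\<dots> \<le> ln (trunc_mass A \<mu>) + \<mu> * P0"
      using H int_le by (simp add: has_bochner_integral_iff)
    finally show ?thesis by simp
  qed
qed

text \<open>The second assumption is complementary slackness: the multiplier vanishes or the power
  constraint is tight. In either case the truncated Gaussian attains the Gibbs bound.\<close>

lemma max_entropy_eq:
  assumes "trunc_moment A \<mu> \<le> P0" "\<mu> * trunc_moment A \<mu> = \<mu> * P0"
  shows "max_entropy A P0 = ereal (ln (trunc_mass A \<mu>) + \<mu> * P0)"
  unfolding max_entropy_def
proof (rule antisym)
  show "(SUP P\<in>admissible_inputs A P0. differential_entropy P) \<le> ereal (ln (trunc_mass A \<mu>) + \<mu> * P0)"
    by (intro SUP_least differential_entropy_le)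
  show "ereal (ln (trunc_mass A \<mu>) + \<mu> * P0) \<le> (SUP P\<in>admissible_inputs A P0. differential_entropy P)"
    using differential_entropy_trunc_density assms(2)
    by (intro SUP_upper2[OF admissible_trunc_density[OF assms(1)]]) simp
qed

end

section \<open>Closed forms of mass and moment, and existence of the multiplier\<close>

lemma trunc_mass_0: "A > 0 \<Longrightarrow> trunc_mass A 0 = 2 * A"
  by (simp add: trunc_mass_def)

lemma trunc_moment_0:
  assumes "A > 0"
  shows "trunc_moment A 0 = A\<^sup>2 / 3"
proof -
  have "((\<lambda>x. x\<^sup>2) has_integral (A ^ 3 / 3 - (- A) ^ 3 / 3)) {-A..A}"
    using assms by (intro fundamental_theorem_of_calculus)
      (auto intro!: derivative_eq_intros simp: has_real_derivative_iff_has_vector_derivative[symmetric] power2_eq_square)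
  then have "integral {-A..A} (\<lambda>x. x\<^sup>2) = 2 * A ^ 3 / 3" by (simp add: integral_unique)
  then show ?thesis using assms
    by (simp add: trunc_moment_def trunc_mass_0 power2_eq_square power3_eq_cube)
qed

lemma gauss_Q_eq: "gauss_Q x = (\<integral>t. indicator {x..} t * std_normal_density t \<partial>lborel)"
proof -
  have "1 / sqrt (2 * pi) * (LBINT t:{x..}. exp (- t\<^sup>2 / 2))
    = (\<integral>t. 1 / sqrt (2 * pi) * (indicator {x..} t *\<^sub>R exp (- t\<^sup>2 / 2)) \<partial>lborel)"
    by (simp only: set_lebesgue_integral_def integral_mult_right_zero)
  then show ?thesis by (simp add: gauss_Q_def std_normal_density_def mult_ac)
qed

lemma integral_std_normal_density_centered:
  assumes "B > 0"
  shows "(\<integral>t. (if \<bar>t\<bar> < B then std_normal_density t else 0) \<partial>lborel) = 1 - 2 * gauss_Q B"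
proof -
  let ?\<phi> = std_normal_density
  have int: "integrable lborel (\<lambda>t. indicator S t * ?\<phi> t)" if "S \<in> sets borel" for S
    using integrable_mult_indicator[of S lborel ?\<phi>] that by simp
  have "(\<integral>t. indicator {..-B} t * ?\<phi> t \<partial>lborel) = (\<integral>t. indicator {..-B} (0 + (-1) * t) * ?\<phi> (0 + (-1) * t) \<partial>lborel)"
    by (subst lborel_integral_real_affine[where c="-1" and t=0]) auto
  also have "\<dots> = gauss_Q B"
    unfolding gauss_Q_eq
    by (intro Bochner_Integration.integral_cong) (auto simp: std_normal_density_def split: split_indicator)
  finally have left: "(\<integral>t. indicator {..-B} t * ?\<phi> t \<partial>lborel) = gauss_Q B" .
  have "1 = (\<integral>t. ?\<phi> t \<partial>lborel)" by simp
  also have "\<dots> = (\<integral>t. indicator {-B<..<B} t * ?\<phi> t + indicator {B..} t * ?\<phi> t + indicator {..-B} t * ?\<phi> t \<partial>lborel)"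
    using assms by (intro Bochner_Integration.integral_cong) (auto split: split_indicator)
  also have "\<dots> = (\<integral>t. indicator {-B<..<B} t * ?\<phi> t \<partial>lborel) + gauss_Q B + gauss_Q B"
    by (simp add: int left gauss_Q_eq[symmetric] del: mult_eq_0_iff)
  also have "(\<integral>t. indicator {-B<..<B} t * ?\<phi> t \<partial>lborel) = (\<integral>t. (if \<bar>t\<bar> < B then ?\<phi> t else 0) \<partial>lborel)"
    by (intro Bochner_Integration.integral_cong) (auto split: split_indicator)
  finally show ?thesis by simp
qed

lemma trunc_mass_gauss_Q:
  assumes "A > 0" "\<mu> > 0"
  shows "trunc_mass A \<mu> = sqrt pi * (1 - 2 * gauss_Q (sqrt (2 * \<mu>) * A)) / sqrt \<mu>"
proof -
  \<comment> \<open>The scaling x = c t with \<open>\<mu> * c\<^sup>2 = 1 / 2\<close> turns the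
    exponent into that of the standard normal density and the end point A into sqrt (2 \<mu>)
    A.\<close>
  define c where "c = 1 / sqrt (2 * \<mu>)"
  have c: "c > 0" using assms by (simp add: c_def)
  have "trunc_mass A \<mu> = (\<integral>x. (if \<bar>x\<bar> < A then exp (- \<mu> * x\<^sup>2) else 0) \<partial>lborel)"
    unfolding trunc_mass_def
    by (rule has_bochner_integral_integral_eq[symmetric], rule has_bochner_integral_centered_interval)
       (intro continuous_intros)
  also have "\<dots> = \<bar>c\<bar> *\<^sub>R (\<integral>t. (if \<bar>0 + c * t\<bar> < A then exp (- \<mu> * (0 + c * t)\<^sup>2) else 0) \<partial>lborel)"
    using c by (intro lborel_integral_real_affine) auto
  also have "(\<lambda>t. if \<bar>0 + c * t\<bar> < A then exp (- \<mu> * (0 + c * t)\<^sup>2) else 0)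
     = (\<lambda>t. sqrt (2 * pi) * (if \<bar>t\<bar> < sqrt (2 * \<mu>) * A then std_normal_density t else 0))"
  proof
    fix t
    have "\<bar>0 + c * t\<bar> < A \<longleftrightarrow> \<bar>t\<bar> < sqrt (2 * \<mu>) * A"
      using assms by (simp add: c_def abs_mult field_simps)
    moreover have "- \<mu> * (0 + c * t)\<^sup>2 = - t\<^sup>2 / 2"
      using assms by (simp add: c_def power_divide)
    ultimately show "(if \<bar>0 + c * t\<bar> < A then exp (- \<mu> * (0 + c * t)\<^sup>2) else 0)
      = sqrt (2 * pi) * (if \<bar>t\<bar> < sqrt (2 * \<mu>) * A then std_normal_density t else 0)"
      by (simp add: std_normal_density_def)
  qed
  also have "(\<integral>t. sqrt (2 * pi) * (if \<bar>t\<bar> < sqrt (2 * \<mu>) * A then std_normal_density t else 0) \<partial>lborel)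
    = sqrt (2 * pi) * (1 - 2 * gauss_Q (sqrt (2 * \<mu>) * A))"
    using assms by (subst integral_mult_right_zero, subst integral_std_normal_density_centered) auto
  finally show ?thesis using assms by (simp add: c_def real_sqrt_mult)
qed

text \<open>The derivative of x exp (- \<mu> x^2) is exp (- \<mu> x^2) - 2 \<mu> x^2 exp (- \<mu>
  x^2); integrating it over [-A, A] ties the second moment to the mass and a boundary term.\<close>

lemma trunc_moment_by_parts:
  assumes "A > 0" "\<mu> > 0"
  shows "trunc_moment A \<mu> = 1 / (2 * \<mu>) - A * exp (- \<mu> * A\<^sup>2) / (\<mu> * trunc_mass A \<mu>)"
proof -
  let ?e = "\<lambda>x::real. exp (- \<mu> * x\<^sup>2)"
  have int: "?e integrable_on {-A..A}" "(\<lambda>x. x\<^sup>2 * ?e x) integrable_on {-A..A}"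
    by (auto intro!: integrable_continuous_real continuous_intros)
  have "((\<lambda>x. ?e x - 2 * \<mu> * (x\<^sup>2 * ?e x)) has_integral (A * ?e A - (- A) * ?e (- A))) {-A..A}"
    using assms by (intro fundamental_theorem_of_calculus)
      (auto intro!: derivative_eq_intros simp: has_real_derivative_iff_has_vector_derivative[symmetric] power2_eq_square algebra_simps)
  then have "integral {-A..A} (\<lambda>x. ?e x - 2 * \<mu> * (x\<^sup>2 * ?e x)) = 2 * A * ?e A"
    by (simp add: integral_unique)
  moreover have "integral {-A..A} (\<lambda>x. ?e x - 2 * \<mu> * (x\<^sup>2 * ?e x)) = trunc_mass A \<mu> - 2 * \<mu> * integral {-A..A} (\<lambda>x. x\<^sup>2 * ?e x)"
    using int by (subst Henstock_Kurzweil_Integration.integral_diff) (auto simp: trunc_mass_def intro!: integrable_on_mult_right)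
  ultimately have "integral {-A..A} (\<lambda>x. x\<^sup>2 * ?e x) = (trunc_mass A \<mu> - 2 * A * ?e A) / (2 * \<mu>)"
    using assms by (simp add: field_simps)
  then show ?thesis
    using assms trunc_mass_pos[of A \<mu>] by (simp add: trunc_moment_def diff_divide_distrib)
qed

lemma trunc_moment_gauss_Q:
  assumes "A > 0" "\<mu> > 0"
  shows "trunc_moment A \<mu> = 1 / (2 * \<mu>)
    - A * exp (- \<mu> * A\<^sup>2) / (sqrt (pi * \<mu>) * (1 - 2 * gauss_Q (sqrt (2 * \<mu>) * A)))"
proof -
  have "\<mu> * trunc_mass A \<mu> = \<mu> / sqrt \<mu> * (sqrt pi * (1 - 2 * gauss_Q (sqrt (2 * \<mu>) * A)))"
    unfolding trunc_mass_gauss_Q[OF assms] by simp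
  also have "\<dots> = sqrt (pi * \<mu>) * (1 - 2 * gauss_Q (sqrt (2 * \<mu>) * A))"
    using assms by (simp only: real_div_sqrt[OF less_imp_le] real_sqrt_mult) simp
  finally have "\<mu> * trunc_mass A \<mu> = sqrt (pi * \<mu>) * (1 - 2 * gauss_Q (sqrt (2 * \<mu>) * A))" .
  then show ?thesis by (simp add: trunc_moment_by_parts[OF assms])
qed

text \<open>Intermediate value theorem in \<mu>: at \<mu> = 0 the moment is A^2 / 3, above P0, which
  also excludes the root 0.\<close>

lemma trunc_moment_surj:
  assumes "A > 0" "0 < P0" "P0 < A\<^sup>2 / 3"
  shows "\<exists>\<mu>>0. trunc_moment A \<mu> = P0"
proof -
  \<comment> \<open>For this \<mu> the Gaussian without truncation has variance exactly P0, and the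
    boundary term in \<open>trunc_moment_by_parts\<close> only lowers the moment.\<close>
  let ?b = "1 / (2 * P0)"
  have b: "?b > 0" using assms by simp
  have "trunc_moment A ?b \<le> 1 / (2 * ?b)"
    using trunc_moment_by_parts[OF assms(1) b] trunc_mass_pos[of A ?b] assms by simp
  then have lo: "trunc_moment A ?b \<le> P0" using assms by simp
  have "continuous_on {0..?b} (\<lambda>\<mu>. integral (cbox (-A) A) (\<lambda>x. exp (- \<mu> * x\<^sup>2)))"
    by (rule integral_continuous_on_param) (auto simp: split_beta' intro!: continuous_intros)
  moreover have "continuous_on {0..?b} (\<lambda>\<mu>. integral (cbox (-A) A) (\<lambda>x. x\<^sup>2 * exp (- \<mu> * x\<^sup>2)))"
    by (rule integral_continuous_on_param) (auto simp: split_beta' intro!: continuous_intros)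
  ultimately have "continuous_on {0..?b} (trunc_moment A)"
    unfolding trunc_moment_def[abs_def] trunc_mass_def cbox_interval
    using trunc_mass_pos[OF assms(1)] by (intro continuous_on_divide) (force simp: trunc_mass_def)+
  then obtain \<mu> where \<mu>: "0 \<le> \<mu>" "trunc_moment A \<mu> = P0"
    using IVT2'[of "trunc_moment A" ?b P0 0] lo b assms trunc_moment_0[OF assms(1)] by auto
  moreover have "\<mu> \<noteq> 0" using \<mu> assms trunc_moment_0[OF assms(1)] by auto
  ultimately show ?thesis by (intro exI[of _ \<mu>]) auto
qed

section \<open>The capacity bound\<close>

lemma interval_density_gaussian_sandwich:
  assumes q: "gaussian_sandwich q" and "prob_space (density lborel (\<lambda>x. ennreal (q x)))"
  shows "interval_density q"
proof
  interpret prob_space "density lborel (\<lambda>x. ennreal (q x))" by fact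
  note [measurable] = gaussian_sandwich_measurable[OF q]
  show "q \<in> borel_measurable borel" by measurable
  show "(\<integral>\<^sup>+x. ennreal (q x) \<partial>lborel) = 1"
    using emeasure_space_1 by (simp add: emeasure_density)
  have supp: "{x. 0 < q x} = UNIV" using gaussian_sandwich_pos[OF q] by auto
  show "open {x. 0 < q x}" "is_interval {x. 0 < q x}" "continuous_on {x. 0 < q x} q"
    unfolding supp using q by (auto simp: gaussian_sandwich_def)
  show "0 \<le> q x" for x using gaussian_sandwich_pos[OF q, of x] by simp
qed

theorem theorem2:
  fixes M :: "'a measure" and W Wq :: "'a \<Rightarrow> real"
    and \<sigma> \<gamma> \<Delta> P0 \<epsilon> A :: real and K :: nat and N :: "real measure"
  assumes "\<sigma> > 0" and "\<gamma> > 0" and "K \<ge> 1" and "\<Delta> = 2 * \<gamma> / real K"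
    and "P0 > 0" and "0 < \<epsilon>" and "\<epsilon> < 1"
    and "prob_space M"
    and "distributed M lborel W (\<lambda>x. ennreal (normal_density 0 \<sigma> x))"
    and "Wq \<in> borel_measurable M"
    and "distr M borel Wq = uniform_measure lborel {- \<Delta> / 2 .. \<Delta> / 2}"
    and "prob_space.indep_var M borel W borel Wq"
    and "N = distr M borel (\<lambda>\<omega>. W \<omega> + Wq \<omega>)"
    and "A > 0"
    and "1 - (cdf N (\<gamma> - A) - cdf N (- \<gamma> - A)) = \<epsilon>"
  shows "\<exists>hW hm :: real.
      differential_entropy N = ereal hW \<and>
      max_entropy A P0 = ereal hm \<and>
      capacity N A P0 \<ge> ereal (1 / 2 * ln (exp (2 * hm) + exp (2 * hW)) - hW) \<and>
      (P0 \<ge> A\<^sup>2 / 3 \<longrightarrow> hm = ln (2 * A)) \<and>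
      (P0 < A\<^sup>2 / 3 \<longrightarrow>
        (let solves = (\<lambda>\<mu>. 1 / (2 * \<mu>)
               - A * exp (- \<mu> * A\<^sup>2) / (sqrt (pi * \<mu>) * (1 - 2 * gauss_Q (sqrt (2 * \<mu>) * A))) = P0);
             c = (\<lambda>\<mu>. sqrt \<mu> / (sqrt pi * (1 - 2 * gauss_Q (sqrt (2 * \<mu>) * A))))
         in (\<exists>\<mu>>0. solves \<mu>) \<and>
            (\<forall>\<mu>>0. solves \<mu> \<longrightarrow> hm = - ln (c \<mu>) + \<mu> * P0)))"
proof -
  note A = \<open>A > 0\<close> and \<sigma> = \<open>\<sigma> > 0\<close>
  interpret M: prob_space M by fact
  let ?U = "distr M borel Wq" and ?G = "density lborel (\<lambda>x. ennreal (normal_density 0 \<sigma> x))"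
  have W: "W \<in> borel_measurable M" "distr M borel W = ?G"
    using \<open>distributed M lborel W _\<close> by (auto simp: distributed_def cong: distr_cong)
  interpret U: prob_space ?U by (rule M.prob_space_distr) fact
  interpret G: prob_space ?G by (rule prob_space_normal_density) fact
  have "AE x in ?U. \<bar>x\<bar> \<le> \<Delta> / 2"
    unfolding \<open>distr M borel Wq = _\<close> by (rule AE_uniform_measureI) auto
  note n = gaussian_sandwich_convolution[OF gaussian_sandwich_normal_density[OF \<sigma>] U.prob_space_axioms _ this G.finite_measure_axioms]
  define n where "n s = (\<integral>x. normal_density 0 \<sigma> (s - x) \<partial>?U)" for s
  have n_sand: "gaussian_sandwich n" and UG: "?U \<star> ?G = density lborel (\<lambda>x. ennreal (n x))"
    using n by (simp_all add: n_def[abs_def])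
  \<comment> \<open>The convolution lemma takes the law of bounded support as its left factor, hence
    the exchange of Gaussian and uniform noise.\<close>
  have "N = (?G \<star> ?U)"
    using M.sum_indep_random_variable[OF \<open>M.indep_var borel W borel Wq\<close> W(1) \<open>Wq \<in> _\<close>] W(2) \<open>N = _\<close> by simp
  also have "\<dots> = (?U \<star> ?G)"
    by (rule convolution_commute) (auto intro: U.finite_measure_axioms G.finite_measure_axioms)
  finally have N: "N = density lborel (\<lambda>x. ennreal (n x))" using UG by simp
  have "prob_space N"
    unfolding \<open>N = distr _ _ _\<close> using W(1) \<open>Wq \<in> _\<close> by (intro M.prob_space_distr) auto
  then have prob_n: "prob_space (density lborel (\<lambda>x. ennreal (n x)))" by (simp add: N)
  then interpret Nn: prob_space "density lborel (\<lambda>x. ennreal (n x))" .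
  have n_dens: "interval_density n" by (rule interval_density_gaussian_sandwich[OF n_sand prob_n])
  note n_meas[measurable] = gaussian_sandwich_measurable[OF n_sand]
    and n_pos = gaussian_sandwich_pos[OF n_sand] and n_int = integrable_gaussian_sandwich_entropy[OF n_sand]
  define hW where "hW = - (\<integral>x. n x * ln (n x) \<partial>lborel)"
  have hW: "differential_entropy N = ereal hW"
    unfolding N hW_def using n_pos n_int by (intro differential_entropy_density) (auto simp: less_imp_le)

  \<comment> \<open>One multiplier serves both regimes: 0 when the uniform law already meets the
    power constraint, otherwise a root that makes the constraint tight.\<close>
  obtain \<mu> where \<mu>: "\<mu> \<ge> 0" "trunc_moment A \<mu> \<le> P0" "\<mu> * trunc_moment A \<mu> = \<mu> * P0"
    and \<mu>0: "P0 \<ge> A\<^sup>2 / 3 \<Longrightarrow> \<mu> = 0"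
  proof (cases "P0 \<ge> A\<^sup>2 / 3")
    case True
    then show thesis using that[of 0] by (simp add: trunc_moment_0[OF A])
  next
    case False
    then obtain \<nu> where "\<nu> > 0" "trunc_moment A \<nu> = P0"
      using trunc_moment_surj[OF A \<open>P0 > 0\<close>] by auto
    then show thesis using that[of \<nu>] False by simp
  qed
  define hm where "hm = ln (trunc_mass A \<mu>) + \<mu> * P0"
  have hm: "max_entropy A P0 = ereal hm"
    unfolding hm_def by (rule max_entropy_eq[OF A \<mu>])
  let ?f = "trunc_density A \<mu>"
  let ?P = "density lborel (\<lambda>x. ennreal (?f x))"
  have adm: "?P \<in> admissible_inputs A P0" by (rule admissible_trunc_density[OF A \<mu>(1,2)])
  then have P: "prob_space ?P" "sets ?P = sets borel" "AE x in ?P. \<bar>x\<bar> \<le> A"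
    by (auto simp: admissible_inputs_def)
  \<comment> \<open>The output density is a second convolution of the same kind, now with the noise
    density as kernel and the truncated Gaussian input as the bounded law.\<close>
  define p where "p s = (\<integral>x. n (s - x) \<partial>?P)" for s
  have p_sand: "gaussian_sandwich p" and conv: "?P \<star> density lborel (\<lambda>x. ennreal (n x)) = density lborel (\<lambda>x. ennreal (p x))"
    using gaussian_sandwich_convolution[OF n_sand P Nn.finite_measure_axioms] by (simp_all add: p_def[abs_def])
  note p = gaussian_sandwich_measurable[OF p_sand] gaussian_sandwich_pos[OF p_sand]
    and p_int = integrable_gaussian_sandwich_entropy[OF p_sand]
  note f_ln = has_bochner_integral_trunc_density_ln[OF A \<mu>(1)]
  have f_int: "integrable lborel (\<lambda>x. ?f x * ln (?f x))" and hf: "hm = - (\<integral>x. ?f x * ln (?f x) \<partial>lborel)"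
    using f_ln \<mu>(3) by (auto simp: has_bochner_integral_iff hm_def)
  have "1 / 2 * ln (exp (2 * hm) + exp (2 * hW)) \<le> - (\<integral>x. p x * ln (p x) \<partial>lborel)"
    by (rule entropy_power_inequality[OF interval_density_trunc_density[OF A \<mu>(1)] n_dens p conv f_int n_int p_int hf hW_def])
  also have "\<dots> = channel_mutual_information ?P N + hW"
    unfolding N hW_def
    by (subst channel_mutual_information_eq[OF P(1,2) n_meas p(1) n_pos prob_n p(2) conv n_int p_int]) simp
  finally have "ereal (1 / 2 * ln (exp (2 * hm) + exp (2 * hW)) - hW) \<le> ereal (channel_mutual_information ?P N)"
    by simp
  then have cap: "capacity N A P0 \<ge> ereal (1 / 2 * ln (exp (2 * hm) + exp (2 * hW)) - hW)"
    unfolding capacity_def by (rule SUP_upper2[OF adm])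

  have large: "hm = ln (2 * A)" if "P0 \<ge> A\<^sup>2 / 3"
    using \<mu>0[OF that] by (simp add: hm_def trunc_mass_0[OF A])
  \<comment> \<open>\<open>hm\<close> was defined from one particular multiplier. For any root \<nu>
    the truncated Gaussian with parameter \<nu> attains the same supremum, so comparing the two
    values of \<open>max_entropy\<close> transfers the formula to \<nu>.\<close>
  have small: "hm = - ln (sqrt \<nu> / (sqrt pi * (1 - 2 * gauss_Q (sqrt (2 * \<nu>) * A)))) + \<nu> * P0"
    if \<nu>: "\<nu> > 0" "trunc_moment A \<nu> = P0" for \<nu>
  proof -
    have "ereal hm = ereal (ln (trunc_mass A \<nu>) + \<nu> * P0)"
      using hm max_entropy_eq[OF A, of \<nu> P0] \<nu> by simp
    moreover have "sqrt \<nu> / (sqrt pi * (1 - 2 * gauss_Q (sqrt (2 * \<nu>) * A))) = 1 / trunc_mass A \<nu>"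
      by (simp add: trunc_mass_gauss_Q[OF A \<nu>(1)])
    ultimately show ?thesis
      using trunc_mass_pos[OF A, of \<nu>] \<nu> by (simp add: ln_divide_pos)
  qed
  have solvable: "\<exists>\<nu>>0. trunc_moment A \<nu> = P0" if "P0 < A\<^sup>2 / 3"
    using trunc_moment_surj[OF A \<open>P0 > 0\<close> that] .
  show ?thesis
    unfolding Let_def
  proof (rule exI[of _ hW], rule exI[of _ hm], intro conjI impI allI)
    show "differential_entropy N = ereal hW" by (fact hW)
    show "max_entropy A P0 = ereal hm" by (fact hm)
    show "capacity N A P0 \<ge> ereal (1 / 2 * ln (exp (2 * hm) + exp (2 * hW)) - hW)" by (fact cap)
    show "hm = ln (2 * A)" if "P0 \<ge> A\<^sup>2 / 3" using that by (fact large)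
    show "\<exists>\<nu>>0. 1 / (2 * \<nu>) - A * exp (- \<nu> * A\<^sup>2)
        / (sqrt (pi * \<nu>) * (1 - 2 * gauss_Q (sqrt (2 * \<nu>) * A))) = P0" if "P0 < A\<^sup>2 / 3"
      using solvable[OF that] trunc_moment_gauss_Q[OF A] by metis
    show "hm = - ln (sqrt \<nu> / (sqrt pi * (1 - 2 * gauss_Q (sqrt (2 * \<nu>) * A)))) + \<nu> * P0"
      if "0 < \<nu>" "1 / (2 * \<nu>) - A * exp (- \<nu> * A\<^sup>2)
        / (sqrt (pi * \<nu>) * (1 - 2 * gauss_Q (sqrt (2 * \<nu>) * A))) = P0" for \<nu>
      using that trunc_moment_gauss_Q[OF A] by (intro small) simp_all
  qed
qed

end
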